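(* Let $n\ge2$ and let $a_1<\cdots<a_n$ be real numbers. Then: 1. If $h(x)=0$ for all $x<0$, then $\mu_{\{a_1,\dots,a_n\}}(dy)=\delta_{a_n}(dy)$ and $k(\{a_1,\dots,a_n\})=0$. 2. If $h(x)=0$ for all $x>0$, then $\mu_{\{a_1,\dots,a_n\}}(dy)=\delta_{a_1}(dy)$ and $k(\{a_1,\dots,a_n\})=0$. 3. If $h(x)>0$ for all $x\ne0$, then $$\mu_{\{a_1,\dots,a_n\}}(dy)=\frac{1}{\mathbf{1}^T\mathbf{H}^{-1}\mathbf{1}}\sum_{i=1}^n(\mathbf{H}^{-1}\mathbf{1})_i\,\delta_{a_i}(dy),\qquad k(\{a_1,\dots,a_n\})=\frac{1}{\mathbf{1}^T\mathbf{H}^{-1}\mathbf{1}}.$$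
   Context: $X=((X_t)_{t\ge 0},(\mathbb{P}_x)_{x\in\mathbb{R}})$ is a one-dimensional Lévy process with $\mathbb{P}_x(X_0=x)=1$ and characteristic exponent $\Psi$ given by $\mathbb{E}_0[e^{i\lambda X_t}]=e^{-t\Psi(\lambda)}$. It is assumed that $X$ is recurrent and that $\int_0^\infty \left|\frac{1}{q+\Psi(\lambda)}\right|d\lambda<\infty$ for every $q>0$. For each $q>0$ the process has a bounded continuous resolvent density $r_q$, i.e. $\int f(y)r_q(y-x)\,dy=\mathbb{E}_x\left[\int_0^\infty e^{-qt}f(X_t)\,dt\right]$ for all $x\in\mathbb{R}$ and bounded measurable $f$, given by $r_q(x)=\frac1\pi\int_0^\infty \Re\left(\frac{e^{-i\lambda x}}{q+\Psi(\lambda)}\right)d\lambda$. Put $h_q(x):=r_q(0)-r_q(-x)$ and define the renormalized zero resolvent $h(x):=\lim_{q\to0+}h_q(x)$ (the limit exists, is finite, and is uniform on compact sets). For a Borel set $A$, $T_A:=\inf\{t\ge 0: X_t\in A\}$. For $q>0$ and nonempty compact $B$, the $q$-capacity measure $m_B^q$ is the unique measure such that $\mathbb{E}_x[e^{-qT_B}]=\int r_q(y-x)\,m_B^q(dy)$ for all $x$; it is supported on $B$. The equilibrium measure $\mu_B$ is the probability measure on $B$ that is the weak limit of $r_q(0)m_B^q$ as $q\to0+$, and the Robin constant is $k(B):=\lim_{q\to0+}r_q(0)\big(r_q(0)m_B^q(B)-1\big)$ (both limits exist). $\mathbf{H}:=\big(h(a_i-a_j)\big)_{i,j=1}^n$ is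 an $n\times n$ matrix (with zero diagonal), and $\mathbf{1}:=(1,\dots,1)^T\in\mathbb{R}^n$. When $h(x)>0$ for all $x\neq0$, $\mathbf{H}$ is invertible and $\mathbf{1}^T\mathbf{H}^{-1}\mathbf{1}\ne0$. $\delta_a$ denotes the Dirac mass at $a$. *)

theory Defs
  imports "HOL-Probability.Probability"
begin

definition cadlag :: "(real \<Rightarrow> real) \<Rightarrow> bool" where
  "cadlag f \<longleftrightarrow>
     (\<forall>t\<ge>0. (f \<longlongrightarrow> f t) (at_right t)) \<and>
     (\<forall>t>0. \<exists>l. (f \<longlongrightarrow> l) (at_left t))"

text \<open>
  All laws \<open>P x\<close> live on the same measurable space. The last three clauses say that, under
  every \<open>P x\<close>, the process starts at \<open>x\<close> and has independent increments whose law depends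
  only on the length of the time interval and not on \<open>x\<close>. Hence the law of \<open>X\<close> under \<open>P x\<close>
  is the law of \<open>x + X\<close> under \<open>P 0\<close>. Only the times \<open>t \<ge> 0\<close> matter.
\<close>

definition levy_process :: "(real \<Rightarrow> 'w measure) \<Rightarrow> (real \<Rightarrow> 'w \<Rightarrow> real) \<Rightarrow> bool" where
  "levy_process P X \<longleftrightarrow>
     (\<forall>x. prob_space (P x)) \<and>
     (\<forall>x. sets (P x) = sets (P 0)) \<and>
     (\<forall>t\<ge>0. X t \<in> borel_measurable (P 0)) \<and>
     (\<forall>\<omega>\<in>space (P 0). cadlag (\<lambda>t. X t \<omega>)) \<and>
     (\<forall>x. AE \<omega> in P x. X 0 \<omega> = x) \<and>
     (\<forall>x s t. 0 \<le> s \<longrightarrow> s \<le> t \<longrightarrow>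
        distr (P x) borel (\<lambda>\<omega>. X t \<omega> - X s \<omega>) = distr (P 0) borel (X (t - s))) \<and>
     (\<forall>x (n::nat) (t::nat \<Rightarrow> real). 0 \<le> t 0 \<longrightarrow> (\<forall>i<n. t i \<le> t (Suc i)) \<longrightarrow>
        prob_space.indep_vars (P x) (\<lambda>_. borel)
          (\<lambda>i \<omega>. X (t (Suc i)) \<omega> - X (t i) \<omega>) {..<n})"

definition characteristic_exponent ::
    "(real \<Rightarrow> 'w measure) \<Rightarrow> (real \<Rightarrow> 'w \<Rightarrow> real) \<Rightarrow> (real \<Rightarrow> complex) \<Rightarrow> bool" where
  "characteristic_exponent P X \<Psi> \<longleftrightarrow>
     (\<forall>t\<ge>0. \<forall>l. char (distr (P 0) borel (X t)) l = exp (- (complex_of_real t * \<Psi> l)))"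

text \<open>
  Recurrence of a Levy process in the sense of potential measures: the expected time
  spent in any open ball around the starting point \<open>0\<close> is infinite.
\<close>

definition recurrent_process :: "(real \<Rightarrow> 'w measure) \<Rightarrow> (real \<Rightarrow> 'w \<Rightarrow> real) \<Rightarrow> bool" where
  "recurrent_process P X \<longleftrightarrow>
     (\<forall>\<epsilon>>0. (\<integral>\<^sup>+t\<in>{0..}. emeasure (P 0) {\<omega> \<in> space (P 0). \<bar>X t \<omega>\<bar> < \<epsilon>} \<partial>lborel) = \<infinity>)"

text \<open>
  Taking \<open>f = 1\<close> in the last clause forces \<open>r\<close> to be integrable, since the right-hand side
  is then \<open>1 / q \<noteq> 0\<close>. By continuity there is at most one such \<open>r\<close>.
\<close>

definition is_resolvent_density ::
    "(real \<Rightarrow> 'w measure) \<Rightarrow> (real \<Rightarrow> 'w \<Rightarrow> real) \<Rightarrow> real \<Rightarrow> (real \<Rightarrow> real) \<Rightarrow> bool" where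
  "is_resolvent_density P X q r \<longleftrightarrow>
     bounded (range r) \<and> continuous_on UNIV r \<and>
     (\<forall>f \<in> borel_measurable borel. bounded (range f) \<longrightarrow>
        (\<forall>x. (\<integral>y. f y * r (y - x) \<partial>lborel) =
             (\<integral>\<omega>. (LINT t:{0..}|lborel. exp (- q * t) * f (X t \<omega>)) \<partial>P x)))"

definition resolvent_density ::
    "(real \<Rightarrow> 'w measure) \<Rightarrow> (real \<Rightarrow> 'w \<Rightarrow> real) \<Rightarrow> real \<Rightarrow> real \<Rightarrow> real" where
  "resolvent_density P X q = (THE r. is_resolvent_density P X q r)"

definition h_resolvent ::
    "(real \<Rightarrow> 'w measure) \<Rightarrow> (real \<Rightarrow> 'w \<Rightarrow> real) \<Rightarrow> real \<Rightarrow> real \<Rightarrow> real" where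
  "h_resolvent P X q x = resolvent_density P X q 0 - resolvent_density P X q (- x)"

definition renormalized_zero_resolvent ::
    "(real \<Rightarrow> 'w measure) \<Rightarrow> (real \<Rightarrow> 'w \<Rightarrow> real) \<Rightarrow> real \<Rightarrow> real" where
  "renormalized_zero_resolvent P X x = Lim (at_right 0) (\<lambda>q. h_resolvent P X q x)"

definition hitting_time :: "(real \<Rightarrow> 'w \<Rightarrow> real) \<Rightarrow> real set \<Rightarrow> 'w \<Rightarrow> ereal" where
  "hitting_time X A \<omega> = (INF t\<in>{t. 0 \<le> t \<and> X t \<omega> \<in> A}. ereal t)"

definition discount :: "real \<Rightarrow> ereal \<Rightarrow> real" where
  "discount q T = (if T = \<infinity> then 0 else exp (- q * real_of_ereal T))"

text \<open>
  The expectation is taken with respect to the completion of \<open>P x\<close>, because hitting times of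
  Borel sets are in general only measurable after completion.
\<close>

definition is_capacity_measure ::
    "(real \<Rightarrow> 'w measure) \<Rightarrow> (real \<Rightarrow> 'w \<Rightarrow> real) \<Rightarrow> real \<Rightarrow> real set \<Rightarrow> real measure \<Rightarrow> bool" where
  "is_capacity_measure P X q B m \<longleftrightarrow>
     sets m = sets borel \<and> finite_measure m \<and> emeasure m (- B) = 0 \<and>
     (\<forall>x. (\<integral>\<omega>. discount q (hitting_time X B \<omega>) \<partial>completion (P x)) =
          (\<integral>y. resolvent_density P X q (y - x) \<partial>m))"

definition capacity_measure ::
    "(real \<Rightarrow> 'w measure) \<Rightarrow> (real \<Rightarrow> 'w \<Rightarrow> real) \<Rightarrow> real \<Rightarrow> real set \<Rightarrow> real measure" where
  "capacity_measure P X q B = (THE m. is_capacity_measure P X q B m)"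

text \<open>
  The library notion of weak convergence is restricted to sequences and is
  phrased through distribution functions. Here the index runs through a filter.
\<close>

definition weakly_tendsto :: "('i \<Rightarrow> real measure) \<Rightarrow> real measure \<Rightarrow> 'i filter \<Rightarrow> bool" where
  "weakly_tendsto m \<mu> F \<longleftrightarrow>
     (\<forall>f::real \<Rightarrow> real. continuous_on UNIV f \<longrightarrow> bounded (range f) \<longrightarrow>
        ((\<lambda>i. \<integral>y. f y \<partial>m i) \<longlongrightarrow> (\<integral>y. f y \<partial>\<mu>)) F)"

definition equilibrium_measure ::
    "(real \<Rightarrow> 'w measure) \<Rightarrow> (real \<Rightarrow> 'w \<Rightarrow> real) \<Rightarrow> real set \<Rightarrow> real measure" where
  "equilibrium_measure P X B =
     (THE \<mu>. prob_space \<mu> \<and> sets \<mu> = sets borel \<and> emeasure \<mu> (- B) = 0 \<and>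
        weakly_tendsto
          (\<lambda>q. scale_measure (ennreal (resolvent_density P X q 0)) (capacity_measure P X q B))
          \<mu> (at_right 0))"

definition robin_constant ::
    "(real \<Rightarrow> 'w measure) \<Rightarrow> (real \<Rightarrow> 'w \<Rightarrow> real) \<Rightarrow> real set \<Rightarrow> real" where
  "robin_constant P X B =
     Lim (at_right 0) (\<lambda>q. resolvent_density P X q 0 *
       (resolvent_density P X q 0 * measure (capacity_measure P X q B) B - 1))"

definition difference_matrix :: "(real \<Rightarrow> real) \<Rightarrow> ('n::finite \<Rightarrow> real) \<Rightarrow> real ^ 'n ^ 'n" where
  "difference_matrix h a = (\<chi> i j. h (a i - a j))"

end

theory Submission
  imports Defs "HOL-Complex_Analysis.Conformal_Mappings" "HOL-Real_Asymp.Real_Asymp"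
begin

text \<open>
  On a finite set the capacity measure \<open>m\<^sup>q\<close> is a vector of masses \<open>m\<^sub>i\<close>. Started at \<open>a\<^sub>j\<close> the
  process is in the set at time \<open>0\<close>, so \<open>\<Sum>\<^sub>i r\<^sub>q(a\<^sub>i - a\<^sub>j) m\<^sub>i = 1\<close> for every \<open>j\<close>. Substituting
  \<open>r\<^sub>q(a\<^sub>i - a\<^sub>j) = r\<^sub>q(0) - h\<^sub>q(a\<^sub>j - a\<^sub>i)\<close> and \<open>\<mu>\<^sub>i = r\<^sub>q(0) m\<^sub>i\<close> turns these equations into
  \<open>\<Sum>\<^sub>i h\<^sub>q(a\<^sub>j - a\<^sub>i) \<mu>\<^sub>i = \<kappa>\<^sub>q\<close> with \<open>\<kappa>\<^sub>q = r\<^sub>q(0) (\<Sum>\<^sub>i \<mu>\<^sub>i - 1)\<close>, and the limit of \<open>\<kappa>\<^sub>q\<close> is the Robin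
  constant (\<open>robin_ratio_eq\<close>). Since \<open>r\<^sub>q \<ge> 0\<close>, each \<open>\<mu>\<^sub>i\<close> lies in \<open>[0, 1]\<close>; hence \<open>\<kappa>\<^sub>q\<close> stays
  bounded. Recurrence makes \<open>r\<^sub>q(0)\<close> tend to infinity (\<open>resolvent_kernel_zero_at_top\<close>), so every
  limit point \<open>\<mu>\<close> solves the system \<open>H \<mu> = k 1\<close>, \<open>1 \<bullet> \<mu> = 1\<close> for some \<open>k\<close>.

  Everything rests on the uniqueness of the solution \<open>(\<mu>, k)\<close> of this limit system
  (\<open>equilibrium_solution_unique\<close>). By Fourier inversion (\<open>fourier_inversion_density\<close>), applied to
  the process at an independent exponential time, whose characteristic function is
  \<open>q / (q + \<Psi>)\<close>,
  \<open>\<Sum>\<^sub>i \<Sum>\<^sub>j v\<^sub>i v\<^sub>j r\<^sub>q(a\<^sub>j - a\<^sub>i) = 1 / (2 \<pi>) \<integral> |\<Sum>\<^sub>j v\<^sub>j e\<^sup>i\<^sup>\<lambda>\<^sup>a\<^sup>(\<^sup>j\<^sup>)|\<^sup>2 Re (1 / (q + \<Psi>(\<lambda>))) d\<lambda>\<close>.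
  For \<open>q \<le> 1\<close> this is bounded below independently of \<open>q\<close>, because
  \<open>Re (1 / (q + \<Psi>)) \<ge> Re \<Psi> / (1 + |\<Psi>|)\<^sup>2\<close>. The bound is strictly positive
  (\<open>energy_uniformly_positive\<close>): a trigonometric sum has only countably many zeros, and \<open>Re \<Psi>\<close> cannot
  vanish almost everywhere. Otherwise \<open>\<Psi>(2\<lambda>) = 2\<Psi>(\<lambda>)\<close> almost everywhere, and scaling \<open>\<lambda>\<close> by \<open>2\<close>
  would give \<open>1 / |q + \<Psi>|\<close> the same integral for \<open>q = 1\<close> and \<open>q = 1/2\<close>. When \<open>\<Sum>\<^sub>i v\<^sub>i = 0\<close>, the
  quadratic form of \<open>h\<^sub>q\<close> is minus this energy, so \<open>H\<close> is strictly negative definite on the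
  hyperplane \<open>1 \<bullet> v = 0\<close>, and the difference of two solutions must be \<open>0\<close>.

  Compactness and uniqueness give convergence (\<open>scaled_mass_converges\<close>), and it only remains to
  exhibit a solution. If \<open>h\<close> vanishes on a half line, the unit mass at an extreme point with
  \<open>k = 0\<close> is one (\<open>concentrated_solution\<close>). If \<open>h > 0\<close> off the origin, then \<open>k > 0\<close>; a vector of
  the kernel of \<open>H\<close> would produce either a second solution or a solution with \<open>k = 0\<close>, so \<open>H\<close> is
  invertible and \<open>\<mu> = k H\<^sup>-\<^sup>1 1\<close> (\<open>positive_h_solution\<close>).
\<close>

section \<open>Laplace transforms, characteristic functions and exponential sums\<close>

lemma laplace_transform_exp:
  fixes z :: complex
  assumes "Re z > 0"
  shows "integrable lborel (\<lambda>t. indicator {0..} t *\<^sub>R exp (- (complex_of_real t * z)))" (is ?int)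
    and "(\<integral>t. indicator {0..} t *\<^sub>R exp (- (complex_of_real t * z)) \<partial>lborel) = 1 / z" (is ?val)
proof -
  have "integrable lborel (\<lambda>t. exponential_density (Re z) t)"
    using prob_space_exponential_density[OF assms]
    by (intro integrableI_nonneg)
       (auto simp: prob_space_def finite_measure_def prob_space_axioms_def emeasure_density exponential_density_nonneg[OF assms])
  then have 1: "integrable lborel (\<lambda>t. (1 / Re z) * exponential_density (Re z) t)"
    by (rule integrable_mult_right)
  show int: ?int
    by (rule Bochner_Integration.integrable_bound[OF 1])
       (use assms in \<open>auto simp: exponential_density_def indicator_def mult.commute\<close>)
  have nz: "z \<noteq> 0" using assms by auto
  have "(LBINT t=0..\<infinity>. exp (- (complex_of_real t * z))) = 0 - (- (1 / z))"
  proof (rule interval_integral_FTC_integrable[where F = "\<lambda>t. - exp (- (complex_of_real t * z)) / z"])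
    show "((\<lambda>t. - exp (- (complex_of_real t * z)) / z) has_vector_derivative exp (- (complex_of_real x * z))) (at x)" for x
      using nz by (intro has_vector_derivative_real_field[where f = "\<lambda>w. - exp (- (w * z)) / z"])
        (auto intro!: derivative_eq_intros)
    show "isCont (\<lambda>t. exp (- (complex_of_real t * z))) x" for x
      by (intro continuous_intros)
    show "set_integrable lborel (einterval 0 \<infinity>) (\<lambda>t. exp (- (complex_of_real t * z)))"
      unfolding set_integrable_def
      by (rule Bochner_Integration.integrable_bound[OF int]) (auto simp: indicator_def einterval_def)
    have "((\<lambda>t. - exp (- (complex_of_real t * z)) / z) \<longlongrightarrow> - exp (- (complex_of_real 0 * z)) / z) (at_right 0)"
      using nz by (intro tendsto_intros)
    then show "(((\<lambda>t. - exp (- (complex_of_real t * z)) / z) \<circ> real_of_ereal) \<longlongrightarrow> - (1 / z)) (at_right 0)"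
      unfolding zero_ereal_def ereal_tendsto_simps by simp
    have "((\<lambda>t. exp (- (t * Re z))) \<longlongrightarrow> 0) at_top"
      using assms by real_asymp
    then have "((\<lambda>t. exp (- (complex_of_real t * z))) \<longlongrightarrow> 0) at_top"
      by (intro tendsto_norm_zero_cancel[of "\<lambda>t. exp (- (complex_of_real t * z))"]) (simp add: o_def)
    then have "((\<lambda>t. - exp (- (complex_of_real t * z)) / z) \<longlongrightarrow> - 0 / z) at_top"
      using nz by (intro tendsto_intros)
    then show "(((\<lambda>t. - exp (- (complex_of_real t * z)) / z) \<circ> real_of_ereal) \<longlongrightarrow> 0) (at_left \<infinity>)"
      unfolding ereal_tendsto_simps by simp
  qed simp_all
  then have *: "(LBINT t=0..\<infinity>. exp (- (complex_of_real t * z))) = 1 / z" by simp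
  have "(LBINT t=0..\<infinity>. exp (- (complex_of_real t * z))) = (\<integral>t. indicator {0..} t *\<^sub>R exp (- (complex_of_real t * z)) \<partial>lborel)"
    unfolding interval_lebesgue_integral_def set_lebesgue_integral_def einterval_def
    using AE_lborel_singleton[of "0::real"]
    by (auto intro!: integral_cong_AE simp: indicator_def elim!: eventually_mono)
  with * show ?val by simp
qed

text \<open>
  Equality in the triangle inequality: if the mean of the unit vectors \<open>iexp (l * x)\<close> has modulus
  one, they are almost surely equal to their mean \<open>z\<close>. Squaring gives the value at \<open>2 * l\<close>.
\<close>

lemma char_double_of_modulus_one:
  assumes "real_distribution M" and "cmod (char M l) = 1"
  shows "char M (2 * l) = (char M l)\<^sup>2"
proof -
  interpret real_distribution M by fact
  define z where "z = char M l"
  have zz: "cnj z * z = 1"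
    using assms(2) unfolding z_def[symmetric] by (metis complex_norm_square mult.commute of_real_1 one_power2)
  have nz: "z \<noteq> 0" using assms(2) z_def by auto
  have int: "integrable M (\<lambda>x. iexp (l * x))"
    by (rule integrable_iexp) auto
  have "(\<integral>x. 1 - cnj z * iexp (l * x) \<partial>M) = 0"
    using int zz by (simp add: prob_space[simplified] z_def char_def)
  moreover have "(\<integral>x. Re (1 - cnj z * iexp (l * x)) \<partial>M) = Re (\<integral>x. 1 - cnj z * iexp (l * x) \<partial>M)"
    using int by (intro integral_Re) auto
  ultimately have 0: "(\<integral>x. Re (1 - cnj z * iexp (l * x)) \<partial>M) = 0" by simp
  have nrm: "cmod (cnj z * iexp (l * x)) = 1" for x
    using assms(2) by (simp add: norm_mult z_def)
  have nn: "0 \<le> Re (1 - cnj z * iexp (l * x))" for x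
    using complex_Re_le_cmod[of "cnj z * iexp (l * x)"] nrm[of x] by simp
  have "AE x in M. Re (1 - cnj z * iexp (l * x)) = 0"
    using integral_nonneg_eq_0_iff_AE[of M "\<lambda>x. Re (1 - cnj z * iexp (l * x))"] 0 nn int
    by simp
  then have "AE x in M. iexp (l * x) = z"
  proof eventually_elim
    case (elim x)
    have "Re (cnj z * iexp (l * x)) = 1" using elim by simp
    moreover from this have "Im (cnj z * iexp (l * x)) = 0"
      using nrm[of x] by (simp add: cmod_def)
    ultimately have "cnj z * iexp (l * x) = cnj z * z"
      unfolding zz by (simp add: complex_eq_iff)
    then show ?case using nz by simp
  qed
  then have "AE x in M. iexp (2 * l * x) = z\<^sup>2"
  proof eventually_elim
    case (elim x)
    have "iexp (2 * l * x) = iexp (l * x) ^ 2"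
      by (simp add: power2_eq_square exp_add[symmetric] algebra_simps)
    then show ?case using elim by simp
  qed
  then have "char M (2 * l) = (\<integral>x. z\<^sup>2 \<partial>M)"
    unfolding char_def by (intro integral_cong_AE) auto
  then show ?thesis by (simp add: prob_space[simplified] z_def)
qed

text \<open>
  As \<open>s\<close> tends to infinity the exponential with the largest \<open>a j\<close> among those with \<open>v j \<noteq> 0\<close>
  dominates all others.
\<close>

lemma exponential_sum_nonzero:
  fixes a v :: "'n::finite \<Rightarrow> real"
  assumes "inj a" and "v k \<noteq> 0"
  shows "\<exists>s. (\<Sum>j\<in>UNIV. v j * exp (s * a j)) \<noteq> 0"
proof -
  define S where "S = {j. v j \<noteq> 0}"
  have S: "finite S" "S \<noteq> {}" using assms by (auto simp: S_def)
  obtain m where m: "m \<in> S" "\<And>j. j \<in> S \<Longrightarrow> a j \<le> a m"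
    using Max_in[of "a ` S"] Max_ge[of "a ` S"] S by fastforce
  have "((\<lambda>s. \<Sum>j\<in>UNIV. v j * exp (s * (a j - a m))) \<longlongrightarrow> (\<Sum>j\<in>UNIV. if j = m then v m else 0)) at_top"
  proof (rule tendsto_sum)
    fix j
    show "((\<lambda>s. v j * exp (s * (a j - a m))) \<longlongrightarrow> (if j = m then v m else 0)) at_top"
    proof (cases "v j = 0 \<or> j = m")
      case True then show ?thesis by auto
    next
      case False
      then have "a j < a m" using m(2)[of j] assms(1) by (auto simp: S_def inj_def less_le)
      then have "((\<lambda>s. v j * exp (s * (a j - a m))) \<longlongrightarrow> 0) at_top" by real_asymp
      then show ?thesis using False by simp
    qed
  qed
  then have "((\<lambda>s. \<Sum>j\<in>UNIV. v j * exp (s * (a j - a m))) \<longlongrightarrow> v m) at_top" by simp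
  moreover have "v m \<noteq> 0" using m(1) by (simp add: S_def)
  ultimately have "eventually (\<lambda>s. (\<Sum>j\<in>UNIV. v j * exp (s * (a j - a m))) \<noteq> 0) at_top"
    by (rule tendsto_imp_eventually_ne)
  then obtain s where s: "(\<Sum>j\<in>UNIV. v j * exp (s * (a j - a m))) \<noteq> 0"
    using eventually_happens'[OF trivial_limit_at_top_linorder] by blast
  have "(\<Sum>j\<in>UNIV. v j * exp (s * a j)) = exp (s * a m) * (\<Sum>j\<in>UNIV. v j * exp (s * (a j - a m)))"
    by (simp add: sum_distrib_left exp_diff algebra_simps)
  with s have "(\<Sum>j\<in>UNIV. v j * exp (s * a j)) \<noteq> 0" by simp
  then show ?thesis by (rule exI)
qed

text \<open>
  The sum is the restriction to the real axis of an entire function, which is not identically zero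
  since it is nonzero somewhere on the imaginary axis; so its zeros are countable.
\<close>

lemma trigonometric_sum_AE_nonzero:
  fixes a v :: "'n::finite \<Rightarrow> real"
  assumes "inj a" and "v k \<noteq> 0"
  shows "AE l in lborel. (\<Sum>j\<in>UNIV. complex_of_real (v j) * iexp (l * a j)) \<noteq> 0"
proof -
  define f where "f z = (\<Sum>j\<in>UNIV. complex_of_real (v j) * exp (\<i> * z * complex_of_real (a j)))" for z
  have hol: "f holomorphic_on UNIV"
    unfolding f_def by (intro holomorphic_intros)
  obtain s where s: "(\<Sum>j\<in>UNIV. v j * exp (s * a j)) \<noteq> 0"
    using exponential_sum_nonzero[of a v k] assms by blast
  have fs: "f (- \<i> * of_real s) = complex_of_real (\<Sum>j\<in>UNIV. v j * exp (s * a j))"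
    by (simp add: f_def exp_of_real[symmetric])
  have "countable {z \<in> UNIV. f z = 0}"
  proof (cases "f constant_on UNIV")
    case True
    then have "f z \<noteq> 0" for z
      using fs s unfolding constant_on_def by (metis UNIV_I of_real_eq_0_iff)
    then show ?thesis by simp
  next
    case False
    then show ?thesis
      by (intro holomorphic_countable_zeros[OF hol]) auto
  qed
  then have "countable (Re ` {z. f z = 0})" by auto
  then have "countable {l. f (complex_of_real l) = 0}"
    by (rule countable_subset[rotated]) (force simp: image_iff)
  then have "AE l in lborel. l \<notin> {l. f (complex_of_real l) = 0}"
    by (intro AE_not_in countable_imp_null_set_lborel)
  then show ?thesis
    by (simp add: f_def algebra_simps)
qed

text \<open>
  The sign in the exponent matters: it is the one produced by \<open>r\<^sub>q(x) = 1 / (2 \<pi>) \<integral> e\<^sup>-\<^sup>i\<^sup>\<lambda>\<^sup>x / (q + \<Psi>(\<lambda>)) d\<lambda>\<close>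
  at \<open>x = a j - a i\<close>.
\<close>

lemma cmod_square_trigonometric_sum:
  fixes a v :: "'n::finite \<Rightarrow> real"
  shows "(\<Sum>i\<in>UNIV. \<Sum>j\<in>UNIV. complex_of_real (v i * v j) * iexp (- (l * (a j - a i))))
    = of_real ((cmod (\<Sum>j\<in>UNIV. complex_of_real (v j) * iexp (l * a j)))\<^sup>2)"
proof -
  let ?S = "\<Sum>j\<in>UNIV. complex_of_real (v j) * iexp (l * a j)"
  have "complex_of_real (v i * v j) * iexp (- (l * (a j - a i)))
      = (complex_of_real (v i) * iexp (l * a i)) * cnj (complex_of_real (v j) * iexp (l * a j))" for i j
  proof -
    have "iexp (- (l * (a j - a i))) = iexp (l * a i) * exp (- (\<i> * of_real (l * a j)))"
      by (simp add: exp_add[symmetric] algebra_simps)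
    then show ?thesis by (simp add: exp_cnj)
  qed
  then have "(\<Sum>i\<in>UNIV. \<Sum>j\<in>UNIV. complex_of_real (v i * v j) * iexp (- (l * (a j - a i)))) = ?S * cnj ?S"
    by (simp only: cnj_sum sum_product)
  then show ?thesis by (simp only: complex_norm_square)
qed

section \<open>Fourier inversion for integrable characteristic functions\<close>

definition inverse_fourier :: "(real \<Rightarrow> complex) \<Rightarrow> real \<Rightarrow> complex" where
  "inverse_fourier \<phi> x = 1 / (2 * pi) * (\<integral>l. iexp (- (l * x)) * \<phi> l \<partial>lborel)"

lemma integrable_iexp_mult:
  assumes "integrable lborel \<phi>"
  shows "integrable lborel (\<lambda>l. iexp (- (l * x)) * \<phi> l)"
  by (rule Bochner_Integration.integrable_bound[OF assms]) (use assms in \<open>auto simp: norm_mult\<close>)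

lemma continuous_inverse_fourier:
  assumes "integrable lborel \<phi>"
  shows "continuous_on UNIV (inverse_fourier \<phi>)"
  unfolding continuous_on_sequentially inverse_fourier_def o_def
proof (intro ballI allI impI tendsto_intros, elim conjE)
  fix a and u :: "nat \<Rightarrow> real" assume u: "u \<longlonglongrightarrow> a"
  show "(\<lambda>n. \<integral>l. iexp (- (l * u n)) * \<phi> l \<partial>lborel) \<longlonglongrightarrow> (\<integral>l. iexp (- (l * a)) * \<phi> l \<partial>lborel)"
  proof (rule integral_dominated_convergence[where w = "\<lambda>l. norm (\<phi> l)"])
    show "AE l in lborel. (\<lambda>n. iexp (- (l * u n)) * \<phi> l) \<longlonglongrightarrow> iexp (- (l * a)) * \<phi> l"
      by (intro AE_I2 tendsto_intros u)
  qed (use assms in \<open>auto simp: norm_mult\<close>)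
qed

lemma norm_inverse_fourier_le:
  assumes "integrable lborel \<phi>"
  shows "norm (inverse_fourier \<phi> x) \<le> 1 / (2 * pi) * (\<integral>l. norm (\<phi> l) \<partial>lborel)"
proof -
  have "norm (\<integral>l. iexp (- (l * x)) * \<phi> l \<partial>lborel) \<le> (\<integral>l. norm (iexp (- (l * x)) * \<phi> l) \<partial>lborel)"
    by (rule integral_norm_bound)
  also have "\<dots> = (\<integral>l. norm (\<phi> l) \<partial>lborel)" by (simp add: norm_mult)
  finally show ?thesis by (simp add: inverse_fourier_def norm_mult norm_divide divide_right_mono)
qed

lemma LINT_Icc_iexp:
  fixes a b t :: real
  assumes "a \<le> b" "t \<noteq> 0"
  shows "(\<integral>x. indicator {a..b} x *\<^sub>R iexp (- (t * x)) \<partial>lborel) = (iexp (- (t * a)) - iexp (- (t * b))) / (\<i> * t)"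
proof -
  have "(\<integral>x. indicator {a..b} x *\<^sub>R iexp (- (t * x)) \<partial>lborel) = \<i> * iexp (- (t * b)) / t - \<i> * iexp (- (t * a)) / t"
  proof (rule integral_FTC_Icc[OF assms(1)])
    fix x :: real
    define c where "c = - (\<i> * of_real t)"
    have "((\<lambda>z. exp (c * z)) has_field_derivative c * exp (c * of_real x)) (at (of_real x))"
      by (auto intro!: derivative_eq_intros)
    from has_vector_derivative_real_field[OF DERIV_cmult[OF this, of "\<i> / of_real t"]]
    have "((\<lambda>x. \<i> / of_real t * exp (c * of_real x)) has_vector_derivative \<i> / of_real t * (c * exp (c * of_real x))) (at x)" .
    moreover have "\<i> / of_real t * (c * w) = w" for w
      using assms(2) by (simp add: c_def field_simps)
    moreover have "exp (c * of_real y) = iexp (- (t * y))" for y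
      by (simp add: c_def mult.assoc)
    ultimately show "((\<lambda>x. \<i> * iexp (- (t * x)) / t) has_vector_derivative iexp (- (t * x))) (at x within {a..b})"
      by (simp add: has_vector_derivative_at_within)
  next
    show "continuous_on {a..b} (\<lambda>x. iexp (- (t * x)))" by (intro continuous_intros)
  qed
  also have "\<dots> = (iexp (- (t * a)) - iexp (- (t * b))) / (\<i> * t)"
    using assms(2) by (simp add: field_simps)
  finally show ?thesis .
qed

lemma integrable_indicator_Icc: "integrable lborel (indicat_real {a..b::real})"
  by (rule integrable_real_indicator) (auto simp: emeasure_lborel_Icc_eq)

text \<open>
  The integrand is the kernel of \<open>Levy_Inversion\<close>. Being the integral of \<open>iexp (- (t * x))\<close> over
  \<open>[a, b]\<close>, it turns Levy's formula for the mass of an interval into the integral of a density by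
  Fubini's theorem.
\<close>

lemma fourier_inversion_interval:
  assumes \<phi>: "integrable lborel \<phi>" and "a \<le> b"
  shows "integrable lborel (\<lambda>t. (iexp (- (t * a)) - iexp (- (t * b))) / (\<i> * complex_of_real t) * \<phi> t)" (is ?int)
    and "1 / (2 * pi) * (\<integral>t. (iexp (- (t * a)) - iexp (- (t * b))) / (\<i> * complex_of_real t) * \<phi> t \<partial>lborel)
      = (\<integral>x. indicator {a..b} x *\<^sub>R inverse_fourier \<phi> x \<partial>lborel)" (is ?val)
proof -
  have [measurable]: "\<phi> \<in> borel_measurable borel" using \<phi> by auto
  have ae: "AE t in lborel. t \<noteq> (0::real)" by (rule AE_lborel_singleton)
  show ?int
  proof (rule Bochner_Integration.integrable_bound[OF integrable_mult_right[OF integrable_norm[OF \<phi>], of "b - a"]])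
    show "AE t in lborel. norm ((iexp (- (t * a)) - iexp (- (t * b))) / (\<i> * complex_of_real t) * \<phi> t) \<le> norm ((b - a) * norm (\<phi> t))"
      using ae
    proof eventually_elim
      case (elim t)
      have "norm ((iexp (- (t * a)) - iexp (- (t * b))) / (\<i> * complex_of_real t)) \<le> b - a"
        using Levy_Inversion_aux2[of "- b" "- a" t] elim assms(2) by simp
      then show ?case using assms(2) unfolding norm_mult[of _ "\<phi> t"] by (simp add: mult_right_mono)
    qed
  qed measurable
  have int2: "integrable (lborel \<Otimes>\<^sub>M lborel) (\<lambda>(t, x). indicator {a..b} x *\<^sub>R (iexp (- (t * x)) * \<phi> t))"
  proof (rule Bochner_Integration.integrable_bound[where f = "\<lambda>(t, x). norm (\<phi> t) * indicator {a..b} x"])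
    show "integrable (lborel \<Otimes>\<^sub>M lborel) (\<lambda>(t, x). norm (\<phi> t) * indicator {a..b} x :: real)"
    proof (rule lborel_pair.Fubini_integrable)
      show "integrable lborel (\<lambda>t. \<integral>x. norm ((case (t, x) of (t, x) \<Rightarrow> norm (\<phi> t) * indicator {a..b} x) :: real) \<partial>lborel)"
        using \<phi> by (simp add: abs_mult)
    qed (use \<phi> in \<open>simp_all add: integrable_indicator_Icc\<close>)
    show "(\<lambda>(t, x). indicator {a..b} x *\<^sub>R (iexp (- (t * x)) * \<phi> t)) \<in> borel_measurable (lborel \<Otimes>\<^sub>M lborel)"
      by measurable
    show "AE p in lborel \<Otimes>\<^sub>M lborel. norm (case p of (t, x) \<Rightarrow> indicator {a..b} x *\<^sub>R (iexp (- (t * x)) * \<phi> t))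
        \<le> norm ((case p of (t, x) \<Rightarrow> norm (\<phi> t) * indicator {a..b} x) :: real)"
      by (intro AE_I2) (simp add: norm_mult split: prod.split)
  qed
  have "(\<integral>t. (iexp (- (t * a)) - iexp (- (t * b))) / (\<i> * complex_of_real t) * \<phi> t \<partial>lborel)
     = (\<integral>t. (\<integral>x. indicator {a..b} x *\<^sub>R (iexp (- (t * x)) * \<phi> t) \<partial>lborel) \<partial>lborel)"
  proof (rule integral_cong_AE)
    show "AE t in lborel. (iexp (- (t * a)) - iexp (- (t * b))) / (\<i> * complex_of_real t) * \<phi> t
        = (\<integral>x. indicator {a..b} x *\<^sub>R (iexp (- (t * x)) * \<phi> t) \<partial>lborel)"
      using ae
    proof eventually_elim
      case (elim t)
      show ?case
        using LINT_Icc_iexp[OF assms(2) elim] by (simp flip: mult_scaleR_left)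
    qed
  qed measurable
  also have "\<dots> = (\<integral>x. (\<integral>t. indicator {a..b} x *\<^sub>R (iexp (- (t * x)) * \<phi> t) \<partial>lborel) \<partial>lborel)"
    by (rule lborel_pair.Fubini_integral[symmetric]) (use int2 in simp)
  finally have swap: "(\<integral>t. (iexp (- (t * a)) - iexp (- (t * b))) / (\<i> * complex_of_real t) * \<phi> t \<partial>lborel)
     = (\<integral>x. (\<integral>t. indicator {a..b} x *\<^sub>R (iexp (- (t * x)) * \<phi> t) \<partial>lborel) \<partial>lborel)" .
  have "indicator {a..b} x *\<^sub>R inverse_fourier \<phi> x
      = 1 / (2 * pi) * (\<integral>t. indicator {a..b} x *\<^sub>R (iexp (- (t * x)) * \<phi> t) \<partial>lborel)" for x
    by (simp add: inverse_fourier_def)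
  then show ?val
    by (simp only: swap integral_mult_right_zero)
qed

text \<open>
  Levy's inversion formula gives the mass of intervals whose endpoints are not atoms. With an
  integrable characteristic function the limit in that formula is an absolutely convergent integral,
  so the mass is the integral of a bounded continuous function. As there are at most countably many
  atoms, this bounds the mass of small neighbourhoods of every point, and there are no atoms at all.
\<close>

theorem fourier_inversion_density:
  assumes "real_distribution M" and \<phi>: "integrable lborel (char M)"
  shows "\<And>x. 0 \<le> Re (inverse_fourier (char M) x)"
    and "M = density lborel (\<lambda>x. ennreal (Re (inverse_fourier (char M) x)))"
proof -
  interpret real_distribution M by fact
  define g where "g x = Re (inverse_fourier (char M) x)" for x
  have gc: "continuous_on UNIV g"
    unfolding g_def by (intro continuous_intros continuous_inverse_fourier \<phi>)
  then have [measurable]: "g \<in> borel_measurable borel"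
    by (rule borel_measurable_continuous_onI)
  define C where "C = 1 / (2 * pi) * (\<integral>l. norm (char M l) \<partial>lborel)"
  have C: "\<bar>g x\<bar> \<le> C" for x
    using norm_inverse_fourier_le[OF \<phi>, of x] abs_Re_le_cmod[of "inverse_fourier (char M) x"]
    unfolding g_def C_def by linarith
  have gint: "integrable lborel (\<lambda>x. indicator {a..b} x *\<^sub>R inverse_fourier (char M) x)" for a b
    using borel_integrable_atLeastAtMost'[OF continuous_on_subset[OF continuous_inverse_fourier[OF \<phi>]], of a b]
    by (simp add: set_integrable_def)
  have ginti: "integrable lborel (\<lambda>x. indicator {a..b} x * g x)" for a b
    using integrable_Re[OF gint[of a b]] by (simp add: g_def)
  \<comment> \<open>The truncated integrals in Levy's formula converge by dominated convergence.\<close>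
  have ivl: "measure M {a<..b} = (\<integral>x. indicator {a..b} x * g x \<partial>lborel)"
    if "a \<le> b" "measure M {a} = 0" "measure M {b} = 0" for a b
  proof -
    define F where "F t = (iexp (- (t * a)) - iexp (- (t * b))) / (\<i> * complex_of_real t) * char M t" for t
    have F: "integrable lborel F"
      unfolding F_def using fourier_inversion_interval(1)[OF \<phi> that(1)] .
    have "(\<lambda>T::nat. \<integral>t. indicator {- real T<..<real T} t *\<^sub>R F t \<partial>lborel) \<longlonglongrightarrow> (\<integral>t. F t \<partial>lborel)"
    proof (rule integral_dominated_convergence[where w = "\<lambda>t. norm (F t)"])
      show "AE t in lborel. (\<lambda>T. indicator {- real T<..<real T} t *\<^sub>R F t) \<longlonglongrightarrow> F t"
      proof (intro AE_I2 tendsto_eventually)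
        fix t :: real
        obtain N :: nat where "\<bar>t\<bar> < N" using reals_Archimedean2 by blast
        then show "\<forall>\<^sub>F T in sequentially. indicator {- real T<..<real T} t *\<^sub>R F t = F t"
          by (auto simp: eventually_sequentially indicator_def intro!: exI[of _ N])
      qed
    qed (use F in \<open>auto simp: indicator_def\<close>)
    then have "(\<lambda>T::nat. 1 / (2 * pi) * (CLBINT t=-T..T. F t)) \<longlonglongrightarrow> 1 / (2 * pi) * (\<integral>t. F t \<partial>lborel)"
      by (intro tendsto_intros)
         (simp add: interval_lebesgue_integral_def set_lebesgue_integral_def einterval_eq)
    moreover have "(\<lambda>T::nat. 1 / (2 * pi) * (CLBINT t=-T..T. F t)) \<longlonglongrightarrow> of_real (measure M {a<..b})"
      unfolding F_def by (rule Levy_Inversion[OF that])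
    ultimately have "complex_of_real (measure M {a<..b}) = 1 / (2 * pi) * (\<integral>t. F t \<partial>lborel)"
      by (intro LIMSEQ_unique)
    also have "\<dots> = (\<integral>x. indicator {a..b} x *\<^sub>R inverse_fourier (char M) x \<partial>lborel)"
      unfolding F_def by (rule fourier_inversion_interval(2)[OF \<phi> that(1)])
    finally have "Re (complex_of_real (measure M {a<..b})) = Re (\<integral>x. indicator {a..b} x *\<^sub>R inverse_fourier (char M) x \<partial>lborel)"
      by (rule arg_cong)
    then show ?thesis
      using integral_Re[OF gint[of a b]] by (simp add: g_def)
  qed
  have nonatom: "\<exists>y\<in>{c<..<d}. measure M {y} = 0" if "c < d" for c d :: real
    using open_minus_countable[OF countable_support, of "{c<..<d}"] that by auto
  have atom: "measure M {x} = 0" for x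
  proof (rule ccontr)
    assume "measure M {x} \<noteq> 0"
    then have pos: "measure M {x} > 0" by (simp add: zero_less_measure_iff)
    \<comment> \<open>Chosen so that an interval of length \<open>2 * e\<close> has mass at most \<open>2 * e * C < measure M {x}\<close>;
      adding 1 to \<open>C\<close> avoids a division by 0.\<close>
    define e where "e = measure M {x} / (4 * (C + 1))"
    have C0: "C \<ge> 0" using C[of 0] by linarith
    have e: "e > 0" using pos C0 by (simp add: e_def)
    obtain a where a: "x - e < a" "a < x" "measure M {a} = 0" using nonatom[of "x - e" x] e by auto
    obtain b where b: "x < b" "b < x + e" "measure M {b} = 0" using nonatom[of x "x + e"] e by auto
    have "measure M {x} \<le> measure M {a<..b}"
      using a b by (intro finite_measure_mono) auto
    also have "\<dots> = (\<integral>x. indicator {a..b} x * g x \<partial>lborel)" using a b by (intro ivl) auto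
    also have "\<dots> \<le> (\<integral>x. indicator {a..b} x * C \<partial>lborel)"
    proof (intro integral_mono ginti)
      show "indicator {a..b} y * g y \<le> indicator {a..b} y * C" for y
        using C[of y] by (auto simp: indicator_def)
    qed (simp add: integrable_indicator_Icc)
    also have "\<dots> = (b - a) * C" using less_trans[OF a(2) b(1)] by simp
    also have "\<dots> \<le> (2 * e) * C" using a b C0 by (intro mult_right_mono) auto
    also have "\<dots> < measure M {x}"
    proof -
      have "e * (4 * (C + 1)) = measure M {x}" using C0 by (simp add: e_def)
      then have "4 * (e * C) + 4 * e = measure M {x}" by (simp add: algebra_simps)
      then show ?thesis using e pos by (simp add: mult.assoc)
    qed
    finally show False by simp
  qed
  have nn: "g x \<ge> 0" for x
  proof (rule ccontr)
    assume "\<not> g x \<ge> 0"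
    then have neg: "g x < 0" by simp
    have "isCont g x" using gc by (simp add: continuous_on_eq_continuous_at)
    then have "\<forall>\<^sub>F y in at x. g y < g x / 2"
      using neg by (intro order_tendstoD(2)[of g "g x"]) (auto simp: isCont_def)
    then obtain d where d: "d > 0" "\<And>y. y \<noteq> x \<Longrightarrow> dist y x < d \<Longrightarrow> g y < g x / 2"
      unfolding eventually_at by auto
    have *: "g y \<le> g x / 2" if "y \<in> {x..x + d / 2}" for y
      using d(2)[of y] that neg d(1) by (cases "y = x") (auto simp: dist_real_def)
    have "0 \<le> measure M {x<..x + d / 2}" by simp
    also have "\<dots> = (\<integral>y. indicator {x..x + d / 2} y * g y \<partial>lborel)"
      using d atom by (intro ivl) auto
    also have "\<dots> \<le> (\<integral>y. indicator {x..x + d / 2} y * (g x / 2) \<partial>lborel)"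
    proof (intro integral_mono ginti)
      show "indicator {x..x + d / 2} y * g y \<le> indicator {x..x + d / 2} y * (g x / 2)" for y
        using *[of y] by (auto simp: indicator_def)
    qed (simp add: integrable_indicator_Icc)
    also have "\<dots> = (d / 2) * (g x / 2)" using d(1) by simp
    also have "\<dots> < 0" using d neg by (simp add: mult_pos_neg)
    finally show False by simp
  qed
  then show "\<And>x. 0 \<le> Re (inverse_fourier (char M) x)" by (simp add: g_def)
  have "M = density lborel g"
  proof (rule measure_eqI_generator_eq[where \<Omega>=UNIV])
    fix X assume "X \<in> range (\<lambda>(a, b). {a<..b::real})"
    then obtain a b where X: "X = {a<..b}" by auto
    show "emeasure M X = emeasure (density lborel g) X"
    proof (cases "a \<le> b")
      case True
      have "emeasure (density lborel g) X = (\<integral>\<^sup>+x. ennreal (indicator {a..b} x * g x) \<partial>lborel)"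
        unfolding X using AE_lborel_singleton[of a]
        by (subst emeasure_density)
           (auto intro!: nn_integral_cong_AE simp: indicator_def elim!: eventually_mono)
      also have "\<dots> = ennreal (\<integral>x. indicator {a..b} x * g x \<partial>lborel)"
        using nn by (intro nn_integral_eq_integral ginti) auto
      also have "\<dots> = emeasure M X"
        unfolding X using ivl[OF True atom atom] by (simp add: emeasure_eq_measure)
      finally show ?thesis ..
    qed (simp add: X)
  next
    show "(\<Union>i. {- real i<..real i}) = UNIV"
      by (rule UN_Ioc_eq_UNIV)
  qed (auto simp: borel_sigma_sets_Ioc Int_stable_def emeasure_eq_measure)
  then show "M = density lborel (\<lambda>x. ennreal (Re (inverse_fourier (char M) x)))"
    by (simp add: g_def)
qed

section \<open>Measures carried by finitely many points\<close>

lemma integral_finite_support: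
  fixes a :: "'n::finite \<Rightarrow> real" and f :: "real \<Rightarrow> real"
  assumes "inj a" "sets m = sets borel" "finite_measure m" "emeasure m (- range a) = 0"
    and [measurable]: "f \<in> borel_measurable borel"
  shows "(\<integral>y. f y \<partial>m) = (\<Sum>i\<in>UNIV. f (a i) * measure m {a i})"
proof -
  interpret finite_measure m by fact
  have [measurable_cong]: "sets m = sets borel" by fact
  have "closed (range a)" by (simp add: finite_imp_closed)
  then have "- range a \<in> null_sets m"
    using assms(2,4) by (auto simp: null_sets_def)
  then have "AE y in m. y \<in> range a" by (rule AE_I') auto
  then have "AE y in m. f y = (\<Sum>i\<in>UNIV. f (a i) * indicator {a i} y)"
  proof eventually_elim
    case (elim y)
    then obtain k where k: "y = a k" by auto
    have "(\<Sum>i\<in>UNIV. f (a i) * indicator {a i} y) = (\<Sum>i\<in>UNIV. if i = k then f (a i) else 0)"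
      using assms(1) by (intro sum.cong) (auto simp: k inj_eq indicator_def)
    then show ?case by (simp add: k)
  qed
  then have "(\<integral>y. f y \<partial>m) = (\<integral>y. (\<Sum>i\<in>UNIV. f (a i) * indicator {a i} y) \<partial>m)"
    by (rule integral_cong_AE[rotated 2]) measurable
  also have "\<dots> = (\<Sum>i\<in>UNIV. \<integral>y. f (a i) * indicator {a i} y \<partial>m)"
    by (rule Bochner_Integration.integral_sum) (use assms(2) in \<open>auto simp: emeasure_eq_measure\<close>)
  also have "\<dots> = (\<Sum>i\<in>UNIV. f (a i) * measure m {a i})"
    using assms(2) sets_eq_imp_space_eq[OF assms(2)] by simp
  finally show ?thesis .
qed

lemma measure_finite_support:
  fixes a :: "'n::finite \<Rightarrow> real"
  assumes "inj a" "sets m = sets borel" "finite_measure m" "emeasure m (- range a) = 0" "A \<in> sets borel"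
  shows "measure m A = (\<Sum>i\<in>UNIV. indicator A (a i) * measure m {a i})"
proof -
  have "measure m A = (\<integral>y. indicator A y \<partial>m)"
    using assms(2,5) sets_eq_imp_space_eq[OF assms(2)] by simp
  also have "\<dots> = (\<Sum>i\<in>UNIV. indicator A (a i) * measure m {a i})"
    by (rule integral_finite_support) (use assms in auto)
  finally show ?thesis .
qed

lemma finite_support_eqI:
  fixes a :: "'n::finite \<Rightarrow> real"
  assumes "inj a" "sets m = sets borel" "finite_measure m" "emeasure m (- range a) = 0"
    and "sets m' = sets borel" "finite_measure m'" "emeasure m' (- range a) = 0"
    and "\<And>i. measure m {a i} = measure m' {a i}"
  shows "m = m'"
proof (rule measure_eqI)
  fix A assume "A \<in> sets m"
  then have A: "A \<in> sets borel" using assms(2) by simp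
  have "measure m A = measure m' A"
    by (simp only: measure_finite_support[OF assms(1-4) A] measure_finite_support[OF assms(1,5-7) A] assms(8))
  then show "emeasure m A = emeasure m' A"
    using assms(3,6) by (simp add: finite_measure.emeasure_eq_measure)
qed (use assms in simp)

definition weighted_points :: "('n::finite \<Rightarrow> real) \<Rightarrow> ('n \<Rightarrow> real) \<Rightarrow> real measure" where
  "weighted_points a w = distr (point_measure UNIV (\<lambda>i. ennreal (w i))) borel a"

lemma weighted_points:
  fixes a w :: "'n::finite \<Rightarrow> real"
  assumes "\<And>i. 0 \<le> w i"
  shows "sets (weighted_points a w) = sets borel"
    and "finite_measure (weighted_points a w)"
    and "emeasure (weighted_points a w) (- range a) = 0"
    and "A \<in> sets borel \<Longrightarrow> measure (weighted_points a w) A = (\<Sum>i\<in>UNIV. w i * indicator A (a i))"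
proof -
  have m [measurable]: "a \<in> point_measure UNIV (\<lambda>i. ennreal (w i)) \<rightarrow>\<^sub>M borel"
    by (simp add: measurable_def space_point_measure sets_point_measure)
  have em: "emeasure (weighted_points a w) A = ennreal (\<Sum>i\<in>UNIV. w i * indicator A (a i))" if "A \<in> sets borel" for A
  proof -
    have "emeasure (weighted_points a w) A = emeasure (point_measure UNIV (\<lambda>i. ennreal (w i))) (a -` A)"
      unfolding weighted_points_def using emeasure_distr[OF m that] by (simp add: space_point_measure)
    also have "\<dots> = (\<Sum>i\<in>a -` A. ennreal (w i))"
      by (rule emeasure_point_measure_finite) auto
    also have "\<dots> = ennreal (\<Sum>i\<in>a -` A. w i)" using assms by (simp add: sum_ennreal)
    also have "(\<Sum>i\<in>a -` A. w i) = (\<Sum>i\<in>UNIV. w i * indicator A (a i))"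
      by (rule sum.mono_neutral_cong_left) (auto simp: indicator_def)
    finally show ?thesis .
  qed
  show "sets (weighted_points a w) = sets borel" by (simp add: weighted_points_def)
  show "finite_measure (weighted_points a w)"
    by (rule finite_measureI) (simp add: em space_distr weighted_points_def[of a w, THEN arg_cong, of space])
  have "closed (range a)" by (simp add: finite_imp_closed)
  then show "emeasure (weighted_points a w) (- range a) = 0" by (subst em) auto
  show "A \<in> sets borel \<Longrightarrow> measure (weighted_points a w) A = (\<Sum>i\<in>UNIV. w i * indicator A (a i))"
    using em[of A] assms by (simp add: measure_def sum_nonneg)
qed

lemma measure_weighted_points_singleton:
  fixes a w :: "'n::finite \<Rightarrow> real"
  assumes "inj a" "\<And>i. 0 \<le> w i"
  shows "measure (weighted_points a w) {a k} = w k"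
proof -
  have "measure (weighted_points a w) {a k} = (\<Sum>i\<in>UNIV. w i * indicator {a k} (a i))"
    by (rule weighted_points(4)) (use assms in auto)
  also have "\<dots> = (\<Sum>i\<in>UNIV. if i = k then w i else 0)"
    using assms(1) by (intro sum.cong) (auto simp: inj_eq indicator_def)
  finally show ?thesis by simp
qed

text \<open>
  These test functions recover the masses of single points from weak convergence.
\<close>

lemma continuous_separation:
  fixes a :: "'n::finite \<Rightarrow> real"
  assumes "inj a"
  shows "\<exists>f::real \<Rightarrow> real. continuous_on UNIV f \<and> bounded (range f) \<and> (\<forall>i. f (a i) = (if i = k then 1 else 0))"
proof -
  obtain d where d: "d > 0" "\<And>x. x \<in> range a \<Longrightarrow> x \<noteq> a k \<Longrightarrow> d \<le> dist (a k) x"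
    using finite_set_avoid[of "range a" "a k"] by auto
  define f where "f x = max 0 (1 - dist (a k) x / d)" for x
  have "continuous_on UNIV f"
    unfolding f_def using d(1) by (intro continuous_intros) auto
  moreover have "bounded (range f)"
    using d(1) by (auto simp: bounded_iff f_def max_def intro!: exI[of _ 1])
  moreover have "f (a i) = (if i = k then 1 else 0)" for i
  proof (cases "i = k")
    case False
    then have "d \<le> dist (a k) (a i)" using assms by (intro d(2)) (auto simp: inj_def)
    then have "1 \<le> dist (a k) (a i) / d" using d(1) by simp
    then show ?thesis using False by (simp add: f_def)
  qed (simp add: f_def)
  ultimately show ?thesis by blast
qed

section \<open>Convergence from uniqueness of limit points\<close>

text \<open>
  Compactness provides a limit point along some sequence \<open>q\<^sub>n \<rightarrow> 0\<close>. If \<open>f\<close> did not converge to it,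
  then some other sequence would stay away from it and yet have a limit point, which by
  uniqueness would be the same.
\<close>

lemma tendsto_at_right_0_of_unique_limit_point:
  fixes f :: "real \<Rightarrow> 'b::metric_space"
  assumes "compact K" and ev: "\<forall>\<^sub>F q in at_right 0. f q \<in> K"
    and lim: "\<And>u z. (\<And>n. 0 < u n) \<Longrightarrow> u \<longlonglongrightarrow> 0 \<Longrightarrow> (\<lambda>n. f (u n)) \<longlonglongrightarrow> z \<Longrightarrow> S z"
    and unique: "\<And>z z'. S z \<Longrightarrow> S z' \<Longrightarrow> z = z'"
  shows "\<exists>z. S z \<and> (f \<longlongrightarrow> z) (at_right 0)"
proof -
  obtain b where b: "b > 0" "\<And>q. 0 < q \<Longrightarrow> q < b \<Longrightarrow> f q \<in> K"
    using ev unfolding eventually_at_right_field by blast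
  have cluster: "\<exists>r z. strict_mono r \<and> S z \<and> (\<lambda>n. f (u (r n))) \<longlonglongrightarrow> z"
    if u: "\<And>n::nat. 0 < u n" "\<And>n. u n < b" "u \<longlonglongrightarrow> 0" for u
  proof -
    have "\<forall>n. (f \<circ> u) n \<in> K" using u b by auto
    then obtain z r where r: "strict_mono r" "((f \<circ> u) \<circ> r) \<longlonglongrightarrow> z"
      using compact_imp_seq_compact[OF assms(1)] unfolding seq_compact_def by blast
    have "(\<lambda>n. u (r n)) \<longlonglongrightarrow> 0"
      using LIMSEQ_subseq_LIMSEQ[OF u(3) r(1)] by (simp add: o_def)
    then have "S z" using r(2) u(1) by (intro lim[of "\<lambda>n. u (r n)"]) (auto simp: o_def)
    then show ?thesis using r by (auto simp: o_def)
  qed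
  have small: "(\<lambda>n. b / (real n + 2)) \<longlonglongrightarrow> 0" by real_asymp
  have less: "b / (real n + 2) < b" for n
  proof -
    have "b * 1 < b * (real n + 2)" using b(1) by (intro mult_strict_left_mono) auto
    then show ?thesis by (simp add: pos_divide_less_eq)
  qed
  have pos: "0 < b / (real n + 2)" for n using b(1) by (intro divide_pos_pos) auto
  obtain z where z: "S z"
    using cluster[of "\<lambda>n. b / (real n + 2)", OF pos less small] by blast
  have "(f \<longlongrightarrow> z) (at_right 0)"
  proof (rule ccontr)
    assume "\<not> (f \<longlongrightarrow> z) (at_right 0)"
    then obtain e where e: "e > 0" "\<not> (\<forall>\<^sub>F q in at_right 0. dist (f q) z < e)"
      unfolding tendsto_iff by blast
    have "\<exists>q. 0 < q \<and> q < b / (real n + 2) \<and> e \<le> dist (f q) z" for n :: nat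
      using pos[of n] e(2) unfolding eventually_at_right_field by (meson not_less)
    then obtain u where u: "\<And>n::nat. 0 < u n" "\<And>n. u n < b / (real n + 2)" "\<And>n. e \<le> dist (f (u n)) z"
      by metis
    have "u \<longlonglongrightarrow> 0"
      by (rule tendsto_sandwich[of "\<lambda>_. 0" _ _ "\<lambda>n. b / (real n + 2)"])
         (use u(1,2) small in \<open>auto simp: less_imp_le\<close>)
    moreover have "u n < b" for n
      using u(2)[of n] less[of n] by linarith
    ultimately obtain r z' where r: "S z'" "(\<lambda>n. f (u (r n))) \<longlonglongrightarrow> z'"
      using cluster[of u] u(1) by blast
    then have "(\<lambda>n. f (u (r n))) \<longlonglongrightarrow> z" using unique[OF z] by simp
    then have "\<forall>\<^sub>F n in sequentially. dist (f (u (r n))) z < e" using e(1) by (rule tendstoD)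
    then obtain n where "dist (f (u (r n))) z < e"
      using eventually_happens'[OF sequentially_bot] by blast
    then show False using u(3)[of "r n"] by simp
  qed
  with z show ?thesis by blast
qed

section \<open>The process at an independent exponential time\<close>

text \<open>
  Since the process lives on \<open>t \<ge> 0\<close>, times enter below as \<open>max 0 t\<close>, which extends the paths to all
  real \<open>t\<close> by a constant.
\<close>

locale levy_resolvent =
  fixes P :: "real \<Rightarrow> 'w measure"
    and X :: "real \<Rightarrow> 'w \<Rightarrow> real"
    and \<Psi> :: "real \<Rightarrow> complex"
  assumes levy: "levy_process P X"
    and exponent: "characteristic_exponent P X \<Psi>"
    and integrable_inverse: "\<And>q::real. q > 0 \<Longrightarrow>
          set_integrable lborel {0..} (\<lambda>l. 1 / (complex_of_real q + \<Psi> l))"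
begin

lemma prob_space_P [simp]: "prob_space (P x)"
  and sets_P: "sets (P x) = sets (P 0)"
  and starts_at: "AE \<omega> in P x. X 0 \<omega> = x"
  and cadlag_paths: "\<omega> \<in> space (P 0) \<Longrightarrow> cadlag (\<lambda>t. X t \<omega>)"
  using levy unfolding levy_process_def by blast+

lemma space_P: "space (P x) = space (P 0)"
  using sets_P by (rule sets_eq_imp_space_eq)

lemma measurable_X [measurable]: "0 \<le> t \<Longrightarrow> X t \<in> borel_measurable (P x)"
  using levy unfolding levy_process_def measurable_cong_sets[OF sets_P[of x] refl] by blast

text \<open>
  Right continuity makes \<open>X\<close> the pointwise limit of the processes frozen at the next point of the
  grid of mesh \<open>1 / (n + 1)\<close>, which take countably many times and are therefore jointly measurable.
\<close>

lemma measurable_paths [measurable]: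
  "(\<lambda>(t, \<omega>). X (max 0 t) \<omega>) \<in> borel_measurable (lborel \<Otimes>\<^sub>M P x)"
proof -
  \<comment> \<open>The maximum keeps the grid points nonnegative. The summand 1 puts them strictly to the right
    of \<open>t\<close>, where the limit of the path is known.\<close>
  define s where "s n i = (max 0 (real_of_int i) + 1) / (real n + 1)" for n :: nat and i :: int
  define g where "g n p = \<lfloor>max 0 (fst p) * (real n + 1)\<rfloor>" for n :: nat and p :: "real \<times> 'w"
  have "(\<lambda>p. X (max 0 (fst p)) (snd p)) \<in> borel_measurable (lborel \<Otimes>\<^sub>M P x)"
  proof (rule borel_measurable_LIMSEQ_metric)
    fix n :: nat
    show "(\<lambda>p. X (s n (g n p)) (snd p)) \<in> borel_measurable (lborel \<Otimes>\<^sub>M P x)"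
    proof (rule measurable_compose_countable)
      fix i
      have "0 \<le> s n i" by (simp add: s_def)
      then show "(\<lambda>p. X (s n i) (snd p)) \<in> borel_measurable (lborel \<Otimes>\<^sub>M P x)" by measurable
    next
      show "g n \<in> (lborel \<Otimes>\<^sub>M P x) \<rightarrow>\<^sub>M count_space UNIV"
        unfolding g_def by measurable
    qed
  next
    fix p :: "real \<times> 'w" assume p: "p \<in> space (lborel \<Otimes>\<^sub>M P x)"
    define t where "t = max 0 (fst p)"
    have t: "0 \<le> t" by (simp add: t_def)
    have snd: "snd p \<in> space (P 0)" using p by (auto simp: space_pair_measure space_P[of x])
    have bounds: "t < s n (g n p)" "s n (g n p) \<le> t + 1 / (real n + 1)" for n
    proof -
      have "0 \<le> t * (real n + 1)" using t by simp
      then have s: "s n (g n p) = (real_of_int \<lfloor>t * (real n + 1)\<rfloor> + 1) / (real n + 1)"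
        by (simp add: s_def g_def t_def[symmetric])
      have "t * (real n + 1) < real_of_int \<lfloor>t * (real n + 1)\<rfloor> + 1"
        by linarith
      then show "t < s n (g n p)" unfolding s by (simp add: pos_less_divide_eq)
      have "real_of_int \<lfloor>t * (real n + 1)\<rfloor> + 1 \<le> t * (real n + 1) + 1" by linarith
      then have "s n (g n p) \<le> (t * (real n + 1) + 1) / (real n + 1)"
        unfolding s by (intro divide_right_mono) auto
      also have "\<dots> = t + 1 / (real n + 1)" by (simp add: add_divide_distrib)
      finally show "s n (g n p) \<le> t + 1 / (real n + 1)" .
    qed
    have "(\<lambda>n. s n (g n p)) \<longlonglongrightarrow> t"
    proof (rule tendsto_sandwich[of "\<lambda>_. t" _ _ "\<lambda>n. t + 1 / (real n + 1)"])
      show "(\<lambda>n. t + 1 / (real n + 1)) \<longlonglongrightarrow> t" by real_asymp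
      show "(\<lambda>n. t) \<longlonglongrightarrow> t" by simp
    qed (use bounds in \<open>simp_all add: less_imp_le\<close>)
    then have "filterlim (\<lambda>n. s n (g n p)) (at_right t) sequentially"
      using bounds(1) less_imp_neq[OF bounds(1)] by (simp add: filterlim_at eq_commute[of "s _ _"])
    moreover have "((\<lambda>u. X u (snd p)) \<longlongrightarrow> X t (snd p)) (at_right t)"
      using cadlag_paths[OF snd] t by (simp add: cadlag_def)
    ultimately show "(\<lambda>n. X (s n (g n p)) (snd p)) \<longlonglongrightarrow> X (max 0 (fst p)) (snd p)"
      unfolding t_def[symmetric] by (rule filterlim_compose[rotated])
  qed
  then show ?thesis by (simp add: case_prod_beta')
qed

lemma integral_shift:
  fixes f :: "real \<Rightarrow> real"
  assumes "0 \<le> t" and [measurable]: "f \<in> borel_measurable borel"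
  shows "(\<integral>\<omega>. f (X t \<omega>) \<partial>P x) = (\<integral>\<omega>. f (x + X t \<omega>) \<partial>P 0)"
proof -
  have [measurable]: "X t \<in> borel_measurable (P y)" "X 0 \<in> borel_measurable (P y)" for y
    using assms(1) by measurable
  have "(\<integral>\<omega>. f (X t \<omega>) \<partial>P x) = (\<integral>\<omega>. f (x + (X t \<omega> - X 0 \<omega>)) \<partial>P x)"
  proof (rule integral_cong_AE)
    show "AE \<omega> in P x. f (X t \<omega>) = f (x + (X t \<omega> - X 0 \<omega>))"
      using starts_at[of x] by eventually_elim simp
  qed measurable
  also have "\<dots> = (\<integral>y. f (x + y) \<partial>distr (P x) borel (\<lambda>\<omega>. X t \<omega> - X 0 \<omega>))"
    by (subst integral_distr) auto
  also have "distr (P x) borel (\<lambda>\<omega>. X t \<omega> - X 0 \<omega>) = distr (P 0) borel (X t)"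
  proof -
    have "\<forall>x s t. 0 \<le> s \<longrightarrow> s \<le> t \<longrightarrow>
        distr (P x) borel (\<lambda>\<omega>. X t \<omega> - X s \<omega>) = distr (P 0) borel (X (t - s))"
      using levy unfolding levy_process_def by (elim conjE)
    from this[rule_format, of 0 t x] show ?thesis using assms(1) by simp
  qed
  also have "(\<integral>y. f (x + y) \<partial>distr (P 0) borel (X t)) = (\<integral>\<omega>. f (x + X t \<omega>) \<partial>P 0)"
    by (subst integral_distr) auto
  finally show ?thesis .
qed

definition exponential_time :: "real \<Rightarrow> real measure" where
  "exponential_time q = density lborel (\<lambda>t. ennreal (exponential_density q t))"

lemma sets_exponential_time [simp, measurable_cong]: "sets (exponential_time q) = sets lborel"
  by (simp add: exponential_time_def)

lemma prob_space_exponential_time: "0 < q \<Longrightarrow> prob_space (exponential_time q)"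
  unfolding exponential_time_def by (rule prob_space_exponential_density)

lemma integral_exponential_time:
  fixes g :: "real \<Rightarrow> 'b::{banach, second_countable_topology}"
  assumes "0 < q" and [measurable]: "g \<in> borel_measurable lborel"
  shows "(\<integral>t. g t \<partial>exponential_time q) = (\<integral>t. exponential_density q t *\<^sub>R g t \<partial>lborel)"
  unfolding exponential_time_def
  by (rule integral_density) (auto simp: exponential_density_nonneg[OF assms(1)])

lemma pair_prob_space_time:
  assumes "0 < q" shows "pair_prob_space (exponential_time q) (P x)"
  using prob_space_exponential_time[OF assms] prob_space_P[of x]
  by (simp add: pair_prob_space_def pair_sigma_finite_def prob_space_imp_sigma_finite)

text \<open>
  The law of \<open>X\<close>, started at \<open>0\<close>, at an independent exponential time of rate \<open>q\<close>. It is \<open>q\<close> times the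
  \<open>q\<close>-resolvent measure.
\<close>

definition killed_law :: "real \<Rightarrow> real measure" where
  "killed_law q = distr (exponential_time q \<Otimes>\<^sub>M P 0) borel (\<lambda>(t, \<omega>). X (max 0 t) \<omega>)"

lemma measurable_paths_time [measurable]:
  "(\<lambda>(t, \<omega>). X (max 0 t) \<omega>) \<in> borel_measurable (exponential_time q \<Otimes>\<^sub>M P x)"
  using measurable_paths[of x] by (simp cong: measurable_cong_sets)

lemma real_distribution_killed_law:
  assumes "0 < q" shows "real_distribution (killed_law q)"
proof -
  interpret pair_prob_space "exponential_time q" "P 0" by (rule pair_prob_space_time[OF assms])
  have "prob_space (killed_law q)"
    unfolding killed_law_def by (rule P.prob_space_distr) measurable
  then show ?thesis
    by (simp add: real_distribution_def real_distribution_axioms_def killed_law_def)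
qed

text \<open>
  Fubini's theorem for the process at an exponential time.
\<close>

lemma integral_killed_law:
  fixes f :: "real \<Rightarrow> 'b::{banach, second_countable_topology}"
  assumes "0 < q" and f [measurable]: "f \<in> borel_measurable borel" and b: "bounded (range f)"
  shows "(\<integral>t. (\<integral>\<omega>. f (X (max 0 t) \<omega>) \<partial>P x) \<partial>exponential_time q)
        = (\<integral>\<omega>. (\<integral>t. f (X (max 0 t) \<omega>) \<partial>exponential_time q) \<partial>P x)"
    and "(\<integral>y. f y \<partial>killed_law q) = (\<integral>t. (\<integral>\<omega>. f (X (max 0 t) \<omega>) \<partial>P 0) \<partial>exponential_time q)"
proof -
  obtain B where B: "\<And>y. norm (f y) \<le> B" using b by (auto simp: bounded_iff)
  have int: "integrable (exponential_time q \<Otimes>\<^sub>M P y) (\<lambda>(t, \<omega>). f (X (max 0 t) \<omega>))" for y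
  proof -
    interpret pair_prob_space "exponential_time q" "P y" by (rule pair_prob_space_time[OF assms(1)])
    show ?thesis
    proof (rule P.integrable_const_bound[where B = B])
      have "(\<lambda>p. f (case p of (t, \<omega>) \<Rightarrow> X (max 0 t) \<omega>)) \<in> borel_measurable (exponential_time q \<Otimes>\<^sub>M P y)"
        by measurable
      then show "(\<lambda>(t, \<omega>). f (X (max 0 t) \<omega>)) \<in> borel_measurable (exponential_time q \<Otimes>\<^sub>M P y)"
        by (simp add: case_prod_beta')
    qed (use B in auto)
  qed
  interpret pair_prob_space "exponential_time q" "P x" by (rule pair_prob_space_time[OF assms(1)])
  show "(\<integral>t. (\<integral>\<omega>. f (X (max 0 t) \<omega>) \<partial>P x) \<partial>exponential_time q)
        = (\<integral>\<omega>. (\<integral>t. f (X (max 0 t) \<omega>) \<partial>exponential_time q) \<partial>P x)"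
    by (rule Fubini_integral[symmetric]) (rule int)
  interpret Z: pair_prob_space "exponential_time q" "P 0" by (rule pair_prob_space_time[OF assms(1)])
  have "(\<integral>y. f y \<partial>killed_law q) = (\<integral>p. f (case p of (t, \<omega>) \<Rightarrow> X (max 0 t) \<omega>) \<partial>(exponential_time q \<Otimes>\<^sub>M P 0))"
    unfolding killed_law_def by (rule integral_distr) measurable
  also have "\<dots> = (\<integral>t. (\<integral>\<omega>. f (X (max 0 t) \<omega>) \<partial>P 0) \<partial>exponential_time q)"
    using Z.integral_fst'[OF int[of 0]] by (simp add: case_prod_beta')
  finally show "(\<integral>y. f y \<partial>killed_law q) = (\<integral>t. (\<integral>\<omega>. f (X (max 0 t) \<omega>) \<partial>P 0) \<partial>exponential_time q)" .
qed

lemma resolvent_eq_killed_law: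
  fixes f :: "real \<Rightarrow> real"
  assumes "0 < q" and [measurable]: "f \<in> borel_measurable borel" and b: "bounded (range f)"
  shows "(\<integral>\<omega>. (LINT t:{0..}|lborel. exp (- q * t) * f (X t \<omega>)) \<partial>P x)
       = 1 / q * (\<integral>y. f (x + y) \<partial>killed_law q)"
proof -
  have path: "(LINT t:{0..}|lborel. exp (- q * t) * f (X t \<omega>)) = 1 / q * (\<integral>t. f (X (max 0 t) \<omega>) \<partial>exponential_time q)"
    if "\<omega> \<in> space (P x)" for \<omega>
  proof -
    have [measurable]: "(\<lambda>t. X (max 0 t) \<omega>) \<in> borel_measurable borel"
      using measurable_compose[OF measurable_Pair2'[OF that, of lborel] measurable_paths[of x]] by simp
    have "(\<integral>t. f (X (max 0 t) \<omega>) \<partial>exponential_time q)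
        = (\<integral>t. q * (indicator {0..} t * (exp (- q * t) * f (X t \<omega>))) \<partial>lborel)"
    proof (subst integral_exponential_time[OF assms(1)])
      show "(\<integral>t. exponential_density q t *\<^sub>R f (X (max 0 t) \<omega>) \<partial>lborel)
          = (\<integral>t. q * (indicator {0..} t * (exp (- q * t) * f (X t \<omega>))) \<partial>lborel)"
        by (intro Bochner_Integration.integral_cong refl)
           (simp add: exponential_density_def indicator_def mult.commute)
    qed measurable
    then show ?thesis using assms(1) by (simp add: set_lebesgue_integral_def)
  qed
  have bx: "bounded (range (\<lambda>y. f (x + y)))"
    using b by (auto simp: bounded_iff)
  have "(\<integral>\<omega>. (LINT t:{0..}|lborel. exp (- q * t) * f (X t \<omega>)) \<partial>P x)
      = 1 / q * (\<integral>\<omega>. (\<integral>t. f (X (max 0 t) \<omega>) \<partial>exponential_time q) \<partial>P x)"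
    using path by (simp cong: Bochner_Integration.integral_cong)
  also have "(\<integral>\<omega>. (\<integral>t. f (X (max 0 t) \<omega>) \<partial>exponential_time q) \<partial>P x)
      = (\<integral>t. (\<integral>\<omega>. f (X (max 0 t) \<omega>) \<partial>P x) \<partial>exponential_time q)"
    by (rule integral_killed_law(1)[symmetric]) (use assms in auto)
  also have "\<dots> = (\<integral>t. (\<integral>\<omega>. f (x + X (max 0 t) \<omega>) \<partial>P 0) \<partial>exponential_time q)"
    by (intro Bochner_Integration.integral_cong refl integral_shift) (use assms in auto)
  also have "\<dots> = (\<integral>y. f (x + y) \<partial>killed_law q)"
    by (rule integral_killed_law(2)[symmetric]) (use assms(1) bx in auto)
  finally show ?thesis .
qed

lemma char_X: "0 \<le> t \<Longrightarrow> char (distr (P 0) borel (X t)) l = exp (- (complex_of_real t * \<Psi> l))"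
  using exponent by (simp add: characteristic_exponent_def)

lemma real_distribution_X: "0 \<le> t \<Longrightarrow> real_distribution (distr (P 0) borel (X t))"
  by (intro prob_space.real_distribution_distr) simp_all

lemma Re_exponent_nonneg: "0 \<le> Re (\<Psi> l)"
  using real_distribution.cmod_char_le_1[OF real_distribution_X[of 1], of l] char_X[of 1 l] by simp

lemma char_killed_law:
  assumes "0 < q"
  shows "char (killed_law q) l = q / (q + \<Psi> l)"
proof -
  have inner: "(\<integral>\<omega>. iexp (l * X (max 0 t) \<omega>) \<partial>P 0) = exp (- (complex_of_real (max 0 t) * \<Psi> l))" for t
    unfolding char_X[symmetric, OF max.cobounded1] char_def by (subst integral_distr) auto
  have "char (killed_law q) l = (\<integral>t. (\<integral>\<omega>. iexp (l * X (max 0 t) \<omega>) \<partial>P 0) \<partial>exponential_time q)"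
    unfolding char_def
    by (rule integral_killed_law(2)) (use assms in \<open>auto simp: bounded_iff intro!: exI[of _ 1]\<close>)
  also have "\<dots> = (\<integral>t. exp (- (complex_of_real (max 0 t) * \<Psi> l)) \<partial>exponential_time q)"
    by (simp only: inner)
  also have "\<dots> = (\<integral>t. of_real q * (indicator {0..} t *\<^sub>R exp (- (complex_of_real t * (q + \<Psi> l)))) \<partial>lborel)"
  proof (subst integral_exponential_time[OF assms])
    show "(\<integral>t. exponential_density q t *\<^sub>R exp (- (complex_of_real (max 0 t) * \<Psi> l)) \<partial>lborel)
      = (\<integral>t. of_real q * (indicator {0..} t *\<^sub>R exp (- (complex_of_real t * (q + \<Psi> l)))) \<partial>lborel)"
    proof (intro Bochner_Integration.integral_cong refl)
      fix t
      have "exp (- (complex_of_real t * (q + \<Psi> l))) = of_real (exp (- t * q)) * exp (- (complex_of_real t * \<Psi> l))"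
        by (simp add: exp_of_real[symmetric] exp_add[symmetric] algebra_simps)
      then show "exponential_density q t *\<^sub>R exp (- (complex_of_real (max 0 t) * \<Psi> l))
          = of_real q * (indicator {0..} t *\<^sub>R exp (- (complex_of_real t * (q + \<Psi> l))))"
        by (cases "t < 0") (simp_all add: exponential_density_def scaleR_conv_of_real)
    qed
  qed measurable
  also have "\<dots> = q / (q + \<Psi> l)"
    unfolding integral_mult_right_zero
    using laplace_transform_exp(2)[of "q + \<Psi> l"] assms Re_exponent_nonneg[of l] by (simp add: add_pos_nonneg del: mult_scaleR_right)
  finally show ?thesis .
qed

section \<open>The resolvent density as a Fourier integral\<close>

lemma exponent_nonzero: "0 < q \<Longrightarrow> complex_of_real q + \<Psi> l \<noteq> 0"
proof
  assume "0 < q" "complex_of_real q + \<Psi> l = 0"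
  then have "Re (complex_of_real q + \<Psi> l) = 0" by simp
  then show False using \<open>0 < q\<close> Re_exponent_nonneg[of l] by simp
qed

lemma measurable_exponent [measurable]: "\<Psi> \<in> borel_measurable borel"
proof -
  have [measurable]: "char (killed_law 1) \<in> borel_measurable borel"
    by (rule real_distribution.char_measurable) (simp add: real_distribution_killed_law)
  have "\<Psi> = (\<lambda>l. 1 / char (killed_law 1) l - 1)"
    by (rule ext) (simp add: char_killed_law)
  also have "\<dots> \<in> borel_measurable borel" by measurable
  finally show ?thesis .
qed

text \<open>
  Characteristic functions are Hermitian, and \<open>\<Psi>\<close> can be read off from that of \<open>killed_law 1\<close>. This
  extends integrability from the half line to the whole line.
\<close>

lemma exponent_minus: "\<Psi> (- l) = cnj (\<Psi> l)"
proof -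
  have "char (killed_law 1) (- l) = cnj (char (killed_law 1) l)"
    unfolding char_def by (subst Bochner_Integration.integral_cnj[symmetric]) (simp add: exp_cnj)
  then show ?thesis by (simp add: char_killed_law)
qed

lemma integrable_inverse_exponent:
  assumes "0 < q"
  shows "integrable lborel (\<lambda>l. 1 / (complex_of_real q + \<Psi> l))"
proof -
  let ?f = "\<lambda>l. 1 / (complex_of_real q + \<Psi> l)"
  have pos: "integrable lborel (\<lambda>l. indicator {0..} l *\<^sub>R ?f l)"
    using integrable_inverse[OF assms] by (simp add: set_integrable_def)
  have neg: "integrable lborel (\<lambda>l. indicator {0..} (- l) *\<^sub>R ?f (- l))"
    using lborel_integrable_real_affine[OF pos, of "-1" 0] by simp
  show ?thesis
  proof (rule Bochner_Integration.integrable_bound)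
    show "integrable lborel (\<lambda>l. norm (indicator {0..} l *\<^sub>R ?f l) + norm (indicator {0..} (- l) *\<^sub>R ?f (- l)))"
      using pos neg by (intro Bochner_Integration.integrable_add integrable_norm)
    have "cmod (?f (- l)) = cmod (?f l)" for l
      unfolding exponent_minus norm_divide
      by (metis complex_cnj_add complex_cnj_complex_of_real complex_mod_cnj)
    then have "norm (?f l) \<le> norm (norm (indicator {0..} l *\<^sub>R ?f l) + norm (indicator {0..} (- l) *\<^sub>R ?f (- l)))" for l
      by (cases "0 \<le> l") simp_all
    then show "AE l in lborel. norm (?f l) \<le> norm (norm (indicator {0..} l *\<^sub>R ?f l) + norm (indicator {0..} (- l) *\<^sub>R ?f (- l)))"
      by simp
  qed measurable
qed

lemma integrable_char_killed_law:
  assumes "0 < q" shows "integrable lborel (char (killed_law q))"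
proof -
  have "char (killed_law q) = (\<lambda>l. q * (1 / (complex_of_real q + \<Psi> l)))"
    using char_killed_law[OF assms] by auto
  then show ?thesis using integrable_mult_right[OF integrable_inverse_exponent[OF assms]] by simp
qed

definition resolvent_kernel :: "real \<Rightarrow> real \<Rightarrow> real" where
  "resolvent_kernel q x = 1 / q * Re (inverse_fourier (char (killed_law q)) x)"

lemma resolvent_kernel_eq:
  assumes "0 < q"
  shows "resolvent_kernel q x = 1 / (2 * pi) * (\<integral>l. Re (iexp (- (l * x)) / (complex_of_real q + \<Psi> l)) \<partial>lborel)"
proof -
  let ?g = "\<lambda>l. iexp (- (l * x)) * (1 / (complex_of_real q + \<Psi> l))"
  have int: "integrable lborel ?g"
    by (rule integrable_iexp_mult[OF integrable_inverse_exponent[OF assms]])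
  have "(\<integral>l. iexp (- (l * x)) * char (killed_law q) l \<partial>lborel) = (\<integral>l. of_real q * ?g l \<partial>lborel)"
    by (simp add: char_killed_law[OF assms] mult_ac)
  also have "\<dots> = of_real q * (\<integral>l. ?g l \<partial>lborel)" by (rule integral_mult_right_zero)
  finally have "inverse_fourier (char (killed_law q)) x = of_real (q / (2 * pi)) * (\<integral>l. ?g l \<partial>lborel)"
    by (simp add: inverse_fourier_def)
  then have "resolvent_kernel q x = 1 / (2 * pi) * Re (\<integral>l. ?g l \<partial>lborel)"
    using assms by (simp add: resolvent_kernel_def)
  also have "Re (\<integral>l. ?g l \<partial>lborel) = (\<integral>l. Re (?g l) \<partial>lborel)"
    by (rule integral_Re[OF int, symmetric])
  finally show ?thesis by simp
qed

lemma integrable_resolvent_integrand: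
  assumes "0 < q"
  shows "integrable lborel (\<lambda>l. Re (iexp (- (l * x)) / (complex_of_real q + \<Psi> l)))"
  using integrable_Re[OF integrable_iexp_mult[OF integrable_inverse_exponent[OF assms], of x]] by simp

lemma resolvent_kernel_nonneg: "0 < q \<Longrightarrow> 0 \<le> resolvent_kernel q x"
  using fourier_inversion_density(1)[OF real_distribution_killed_law integrable_char_killed_law]
  by (simp add: resolvent_kernel_def)

lemma killed_law_density:
  assumes "0 < q"
  shows "killed_law q = density lborel (\<lambda>x. ennreal (q * resolvent_kernel q x))"
  using fourier_inversion_density(2)[OF real_distribution_killed_law[OF assms] integrable_char_killed_law[OF assms]] assms
  by (simp add: resolvent_kernel_def)

lemma continuous_resolvent_kernel: "0 < q \<Longrightarrow> continuous_on UNIV (resolvent_kernel q)"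
  unfolding resolvent_kernel_def
  by (intro continuous_intros continuous_inverse_fourier integrable_char_killed_law)

lemma measurable_resolvent_kernel [measurable]: "0 < q \<Longrightarrow> resolvent_kernel q \<in> borel_measurable borel"
  by (rule borel_measurable_continuous_onI[OF continuous_resolvent_kernel])

lemma bounded_resolvent_kernel:
  assumes "0 < q" shows "bounded (range (resolvent_kernel q))"
proof -
  let ?C = "1 / q * (1 / (2 * pi) * (\<integral>l. norm (char (killed_law q) l) \<partial>lborel))"
  have "\<bar>resolvent_kernel q x\<bar> \<le> ?C" for x
  proof -
    have "\<bar>resolvent_kernel q x\<bar> = 1 / q * \<bar>Re (inverse_fourier (char (killed_law q)) x)\<bar>"
      using assms by (simp add: resolvent_kernel_def)
    also have "\<dots> \<le> 1 / q * cmod (inverse_fourier (char (killed_law q)) x)"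
      using assms abs_Re_le_cmod by (intro mult_left_mono) auto
    also have "\<dots> \<le> ?C"
      using assms norm_inverse_fourier_le[OF integrable_char_killed_law[OF assms]] by (intro mult_left_mono) auto
    finally show ?thesis .
  qed
  then show ?thesis by (auto simp: bounded_iff intro!: exI[of _ ?C])
qed

lemma resolvent_kernel_is_resolvent_density:
  assumes "0 < q" shows "is_resolvent_density P X q (resolvent_kernel q)"
  unfolding is_resolvent_density_def
proof (intro conjI ballI impI allI)
  fix f :: "real \<Rightarrow> real" and x
  assume f [measurable]: "f \<in> borel_measurable borel" and b: "bounded (range f)"
  have [measurable]: "resolvent_kernel q \<in> borel_measurable borel" by (rule measurable_resolvent_kernel[OF assms])
  have "(\<integral>\<omega>. (LINT t:{0..}|lborel. exp (- q * t) * f (X t \<omega>)) \<partial>P x) = 1 / q * (\<integral>y. f (x + y) \<partial>killed_law q)"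
    by (rule resolvent_eq_killed_law[OF assms f b])
  also have "(\<integral>y. f (x + y) \<partial>killed_law q) = (\<integral>y. (q * resolvent_kernel q y) *\<^sub>R f (x + y) \<partial>lborel)"
    unfolding killed_law_density[OF assms]
    by (rule integral_density) (use resolvent_kernel_nonneg[OF assms] assms in auto)
  also have "1 / q * \<dots> = (\<integral>y. f (x + y) * resolvent_kernel q y \<partial>lborel)"
  proof -
    have "(\<integral>y. (q * resolvent_kernel q y) *\<^sub>R f (x + y) \<partial>lborel) = (\<integral>y. q * (f (x + y) * resolvent_kernel q y) \<partial>lborel)"
      by (simp add: mult_ac)
    then show ?thesis using assms by simp
  qed
  also have "\<dots> = (\<integral>y. f y * resolvent_kernel q (y - x) \<partial>lborel)"
    using lborel_integral_real_affine[of 1 "\<lambda>y. f y * resolvent_kernel q (y - x)" x] by simp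
  finally show "(\<integral>y. f y * resolvent_kernel q (y - x) \<partial>lborel)
      = (\<integral>\<omega>. (LINT t:{0..}|lborel. exp (- q * t) * f (X t \<omega>)) \<partial>P x)" ..
qed (use assms continuous_resolvent_kernel bounded_resolvent_kernel in auto)

lemma is_resolvent_densityD:
  assumes "is_resolvent_density P X q r" "f \<in> borel_measurable borel" "bounded (range f)"
  shows "(\<integral>y. f y * r (y - x) \<partial>lborel) = (\<integral>\<omega>. (LINT t:{0..}|lborel. exp (- q * t) * f (X t \<omega>)) \<partial>P x)"
  using assms unfolding is_resolvent_density_def by blast

text \<open>
  Resolvent densities are integrable, as their integral \<open>1 / q\<close> is not the default value \<open>0\<close>. So the
  sign of the difference of two densities may serve as a test function, which shows that they agree
  almost everywhere and, by continuity, everywhere.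
\<close>

lemma resolvent_density_eq_resolvent_kernel:
  assumes "0 < q" shows "resolvent_density P X q = resolvent_kernel q"
  unfolding resolvent_density_def
proof (rule the_equality)
  show "is_resolvent_density P X q (resolvent_kernel q)"
    by (rule resolvent_kernel_is_resolvent_density[OF assms])
next
  fix r assume r: "is_resolvent_density P X q r"
  note k = resolvent_kernel_is_resolvent_density[OF assms]
  have same: "(\<integral>y. f y * r y \<partial>lborel) = (\<integral>y. f y * resolvent_kernel q y \<partial>lborel)"
    if "f \<in> borel_measurable borel" "bounded (range f)" for f :: "real \<Rightarrow> real"
  proof -
    have "(\<integral>y. f y * r (y - 0) \<partial>lborel) = (\<integral>y. f y * resolvent_kernel q (y - 0) \<partial>lborel)"
      by (simp only: is_resolvent_densityD[OF r that] is_resolvent_densityD[OF k that])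
    then show ?thesis by simp
  qed
  have rc: "continuous_on UNIV r" using r by (simp add: is_resolvent_density_def)
  have [measurable]: "r \<in> borel_measurable borel" "resolvent_kernel q \<in> borel_measurable borel"
    using borel_measurable_continuous_onI[OF rc] measurable_resolvent_kernel[OF assms] by auto
  have one: "(\<integral>y. g y \<partial>lborel) = 1 / q" if "is_resolvent_density P X q g" for g
  proof -
    have "(\<integral>y. 1 * g (y - 0) \<partial>lborel) = (\<integral>\<omega>. (LINT t:{0..}|lborel. exp (- q * t) * 1) \<partial>P 0)"
      by (rule is_resolvent_densityD[OF that]) auto
    also have "\<dots> = 1 / q * (\<integral>y. 1 \<partial>killed_law q)"
      by (rule resolvent_eq_killed_law[OF assms]) auto
    also have "\<dots> = 1 / q"
      using real_distribution_killed_law[OF assms]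
      by (simp add: real_distribution_def prob_space.prob_space)
    finally show ?thesis by simp
  qed
  have ri: "integrable lborel r" "integrable lborel (resolvent_kernel q)"
    using one[OF r] one[OF k] assms not_integrable_integral_eq[of lborel r]
      not_integrable_integral_eq[of lborel "resolvent_kernel q"] by auto
  have "(\<integral>y. \<bar>r y - resolvent_kernel q y\<bar> \<partial>lborel) = (\<integral>y. sgn (r y - resolvent_kernel q y) * r y - sgn (r y - resolvent_kernel q y) * resolvent_kernel q y \<partial>lborel)"
    by (intro Bochner_Integration.integral_cong refl) (simp add: abs_sgn algebra_simps)
  also have "\<dots> = (\<integral>y. sgn (r y - resolvent_kernel q y) * r y \<partial>lborel) - (\<integral>y. sgn (r y - resolvent_kernel q y) * resolvent_kernel q y \<partial>lborel)"
  proof (rule Bochner_Integration.integral_diff)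
    show "integrable lborel (\<lambda>y. sgn (r y - resolvent_kernel q y) * r y)"
      by (rule Bochner_Integration.integrable_bound[OF ri(1)]) (auto simp: abs_mult sgn_if)
    show "integrable lborel (\<lambda>y. sgn (r y - resolvent_kernel q y) * resolvent_kernel q y)"
      by (rule Bochner_Integration.integrable_bound[OF ri(2)]) (auto simp: abs_mult sgn_if)
  qed
  also have "\<dots> = 0"
  proof -
    have "bounded (range (\<lambda>y. sgn (r y - resolvent_kernel q y)))"
      by (auto simp: bounded_iff sgn_if intro!: exI[of _ 1])
    then show ?thesis by (subst same) auto
  qed
  finally have "AE y in lborel. \<bar>r y - resolvent_kernel q y\<bar> = 0"
    using ri by (subst (asm) integral_nonneg_eq_0_iff_AE) auto
  then have "AE y in lebesgue. y \<in> {y. r y = resolvent_kernel q y}"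
    by (intro AE_completion) simp
  moreover have "closed {y. r y = resolvent_kernel q y}"
    using rc continuous_resolvent_kernel[OF assms] by (intro closed_Collect_eq)
  ultimately show "r = resolvent_kernel q"
    using mem_closed_if_AE_lebesgue by blast
qed

section \<open>The energy form of the resolvent\<close>

text \<open>
  The energy of the charge with mass \<open>v i\<close> at \<open>a i\<close>, the resolvent density being the potential
  kernel.
\<close>

definition energy :: "real \<Rightarrow> ('n::finite \<Rightarrow> real) \<Rightarrow> ('n \<Rightarrow> real) \<Rightarrow> real" where
  "energy q a v = (\<Sum>i\<in>UNIV. \<Sum>j\<in>UNIV. v i * v j * resolvent_kernel q (a j - a i))"

lemma energy_eq_integral:
  fixes a v :: "'n::finite \<Rightarrow> real"
  assumes q: "0 < q"
  defines "F l \<equiv> (cmod (\<Sum>j\<in>UNIV. complex_of_real (v j) * iexp (l * a j)))\<^sup>2"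
  shows "integrable lborel (\<lambda>l. F l * Re (1 / (complex_of_real q + \<Psi> l)))"
    and "energy q a v = 1 / (2 * pi) * (\<integral>l. F l * Re (1 / (complex_of_real q + \<Psi> l)) \<partial>lborel)"
proof -
  let ?k = "\<lambda>i j l. v i * v j * Re (iexp (- (l * (a j - a i))) / (complex_of_real q + \<Psi> l))"
  have int: "integrable lborel (?k i j)" for i j
    by (intro integrable_mult_right integrable_resolvent_integrand[OF q])
  have eq: "(\<Sum>i\<in>UNIV. \<Sum>j\<in>UNIV. ?k i j l) = F l * Re (1 / (complex_of_real q + \<Psi> l))" for l
  proof -
    have "(\<Sum>i\<in>UNIV. \<Sum>j\<in>UNIV. ?k i j l)
        = Re ((\<Sum>i\<in>UNIV. \<Sum>j\<in>UNIV. complex_of_real (v i * v j) * iexp (- (l * (a j - a i)))) * (1 / (complex_of_real q + \<Psi> l)))"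
      unfolding sum_distrib_right Re_sum
    proof (intro sum.cong refl)
      fix i j
      have "Re (complex_of_real c * w * (1 / z)) = c * Re (w / z)" for c w z
      proof -
        have "complex_of_real c * w * (1 / z) = complex_of_real c * (w / z)" by simp
        then show ?thesis by (simp only: times_complex.sel Re_complex_of_real Im_complex_of_real mult_zero_left diff_zero)
      qed
      then show "?k i j l = Re (complex_of_real (v i * v j) * iexp (- (l * (a j - a i))) * (1 / (complex_of_real q + \<Psi> l)))"
        by metis
    qed
    also have "\<dots> = F l * Re (1 / (complex_of_real q + \<Psi> l))"
      unfolding cmod_square_trigonometric_sum F_def by (simp only: Re_complex_of_real times_complex.sel Im_complex_of_real)
    finally show ?thesis .
  qed
  have "integrable lborel (\<lambda>l. \<Sum>i\<in>UNIV. \<Sum>j\<in>UNIV. ?k i j l)"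
    by (intro Bochner_Integration.integrable_sum int)
  then show "integrable lborel (\<lambda>l. F l * Re (1 / (complex_of_real q + \<Psi> l)))"
    by (simp only: eq)
  have "energy q a v = (\<Sum>i\<in>UNIV. \<Sum>j\<in>UNIV. 1 / (2 * pi) * (\<integral>l. ?k i j l \<partial>lborel))"
    unfolding energy_def resolvent_kernel_eq[OF q] integral_mult_right_zero by (simp add: mult_ac)
  also have "\<dots> = 1 / (2 * pi) * (\<integral>l. (\<Sum>i\<in>UNIV. \<Sum>j\<in>UNIV. ?k i j l) \<partial>lborel)"
    by (simp only: Bochner_Integration.integral_sum Bochner_Integration.integrable_sum int sum_distrib_left)
  finally show "energy q a v = 1 / (2 * pi) * (\<integral>l. F l * Re (1 / (complex_of_real q + \<Psi> l)) \<partial>lborel)"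
    by (simp only: eq)
qed

text \<open>
  A lower bound that does not depend on \<open>q\<close> takes the place of a limit under the integral as
  \<open>q\<close> tends to \<open>0\<close>.
\<close>

lemma Re_inverse_exponent_ge:
  assumes "0 < q" "q \<le> 1"
  shows "Re (\<Psi> l) / (1 + cmod (\<Psi> l))\<^sup>2 \<le> Re (1 / (complex_of_real q + \<Psi> l))"
proof -
  let ?z = "complex_of_real q + \<Psi> l"
  have nz: "cmod ?z > 0" using exponent_nonzero[OF assms(1), of l] by simp
  have "cmod ?z \<le> 1 + cmod (\<Psi> l)"
    using norm_triangle_ineq[of "complex_of_real q" "\<Psi> l"] assms by simp
  then have sq: "(cmod ?z)\<^sup>2 \<le> (1 + cmod (\<Psi> l))\<^sup>2" by (intro power_mono) auto
  have "Re (\<Psi> l) / (1 + cmod (\<Psi> l))\<^sup>2 \<le> Re ?z / (cmod ?z)\<^sup>2"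
    using Re_exponent_nonneg[of l] assms nz sq by (intro frac_le) auto
  also have "\<dots> = Re (1 / ?z)"
    by (simp add: Re_divide cmod_power2)
  finally show ?thesis .
qed

lemma energy_nonneg:
  assumes "0 < q" shows "0 \<le> energy q a v"
proof -
  have "0 \<le> Re (1 / (complex_of_real q + \<Psi> l))" for l
    using Re_exponent_nonneg[of l] assms by (simp add: Re_divide)
  then show ?thesis
    unfolding energy_eq_integral(2)[OF assms] by (intro mult_nonneg_nonneg Bochner_Integration.integral_nonneg) auto
qed

text \<open>
  Here \<open>X t\<close> has a characteristic function of modulus one at \<open>l\<close> for every \<open>t\<close>. This determines
  \<open>exp (- t \<Psi>(2 l))\<close> for all \<open>t\<close>, and the Laplace transform in \<open>t\<close> recovers the exponent without
  the choice of a logarithm.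
\<close>

lemma exponent_double:
  assumes "Re (\<Psi> l) = 0"
  shows "\<Psi> (2 * l) = 2 * \<Psi> l"
proof -
  have eq: "exp (- (complex_of_real t * \<Psi> (2 * l))) = exp (- (complex_of_real t * (2 * \<Psi> l)))" if "0 \<le> t" for t
  proof -
    have "cmod (char (distr (P 0) borel (X t)) l) = 1"
      unfolding char_X[OF that] by (simp add: assms)
    from char_double_of_modulus_one[OF real_distribution_X[OF that] this]
    show ?thesis
      unfolding char_X[OF that] by (simp add: power2_eq_square exp_add[symmetric] algebra_simps)
  qed
  have "1 / (1 + \<Psi> (2 * l)) = (\<integral>t. indicator {0..} t *\<^sub>R exp (- (complex_of_real t * (1 + \<Psi> (2 * l)))) \<partial>lborel)"
    using Re_exponent_nonneg[of "2 * l"] by (intro laplace_transform_exp(2)[symmetric]) simp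
  also have "\<dots> = (\<integral>t. indicator {0..} t *\<^sub>R exp (- (complex_of_real t * (1 + 2 * \<Psi> l))) \<partial>lborel)"
  proof (intro Bochner_Integration.integral_cong refl)
    fix t
    have "exp (- (complex_of_real t * (1 + z))) = exp (- complex_of_real t) * exp (- (complex_of_real t * z))" for z
      by (simp add: exp_add[symmetric] algebra_simps)
    then show "indicator {0..} t *\<^sub>R exp (- (complex_of_real t * (1 + \<Psi> (2 * l))))
        = indicator {0..} t *\<^sub>R exp (- (complex_of_real t * (1 + 2 * \<Psi> l)))"
      using eq[of t] by (cases "0 \<le> t") simp_all
  qed
  also have "\<dots> = 1 / (1 + 2 * \<Psi> l)"
    using assms by (intro laplace_transform_exp(2)) simp
  finally show ?thesis by simp
qed

text \<open>
  Such a process would be a deterministic drift, which has no resolvent density. Analytically: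
  if \<open>\<Psi>\<close> is imaginary almost everywhere, then \<open>\<Psi>(2 l) = 2 \<Psi>(l)\<close>, and the substitution \<open>l \<mapsto> 2 l\<close>
  shows that \<open>1 / |1 + \<Psi>|\<close> and the strictly larger function \<open>1 / |1/2 + \<Psi>|\<close> have the same
  finite integral.
\<close>

lemma not_AE_Re_exponent_zero: "\<not> (AE l in lborel. Re (\<Psi> l) = 0)"
proof
  assume ae: "AE l in lborel. Re (\<Psi> l) = 0"
  let ?f = "\<lambda>q l. cmod (1 / (complex_of_real q + \<Psi> l))"
  have int: "integrable lborel (?f q)" if "0 < q" for q
    by (rule integrable_norm[OF integrable_inverse_exponent[OF that]])
  have "(\<integral>l. ?f 1 l \<partial>lborel) = 2 * (\<integral>l. ?f 1 (2 * l) \<partial>lborel)"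
    using lborel_integral_real_affine[of 2 "?f 1" 0] by simp
  also have "\<dots> = (\<integral>l. 2 * ?f 1 (2 * l) \<partial>lborel)" by (rule integral_mult_right_zero[symmetric])
  also have "\<dots> = (\<integral>l. ?f (1 / 2) l \<partial>lborel)"
  proof (rule integral_cong_AE)
    show "AE l in lborel. 2 * ?f 1 (2 * l) = ?f (1 / 2) l"
      using ae
    proof eventually_elim
      case (elim l)
      have "complex_of_real 1 + \<Psi> (2 * l) = 2 * (complex_of_real (1 / 2) + \<Psi> l)"
        by (simp only: exponent_double[OF elim]) (simp add: algebra_simps)
      then show ?case by (simp only: norm_divide norm_mult) simp
    qed
  qed measurable
  finally have "(\<integral>l. ?f (1 / 2) l - ?f 1 l \<partial>lborel) = 0"
    using int[of 1] int[of "1 / 2"] by simp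
  moreover have lt: "AE l in lborel. ?f 1 l < ?f (1 / 2) l"
    using ae
  proof eventually_elim
    case (elim l)
    have "cmod (complex_of_real (1 / 2) + \<Psi> l) < cmod (complex_of_real 1 + \<Psi> l)"
      unfolding cmod_def using elim by (simp add: power2_eq_square)
    moreover have "0 < cmod (complex_of_real (1 / 2) + \<Psi> l)"
      using exponent_nonzero[of "1 / 2" l] by simp
    ultimately show ?case unfolding norm_divide by (intro frac_less2) auto
  qed
  then have "AE l in lborel. 0 \<le> ?f (1 / 2) l - ?f 1 l" by eventually_elim simp
  ultimately have "AE l in lborel. ?f (1 / 2) l - ?f 1 l = 0"
    using int[of 1] int[of "1 / 2"] by (subst (asm) integral_nonneg_eq_0_iff_AE) auto
  with lt have "AE l::real in lborel. l \<in> {}" by eventually_elim simp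
  then show False
    using mem_closed_if_AE_lebesgue[of "{}::real set" 0] AE_completion by blast
qed

text \<open>
  The lower bound on \<open>Re (1 / (q + \<Psi>))\<close> gives a constant \<open>c\<close> that serves all \<open>q \<le> 1\<close>. If \<open>c\<close> were \<open>0\<close>,
  then \<open>Re \<Psi>\<close> would vanish almost everywhere.
\<close>

lemma energy_uniformly_positive:
  fixes a v :: "'n::finite \<Rightarrow> real"
  assumes "inj a" "v k \<noteq> 0"
  shows "\<exists>c>0. \<forall>q. 0 < q \<longrightarrow> q \<le> 1 \<longrightarrow> c \<le> energy q a v"
proof -
  define F where "F l = (cmod (\<Sum>j\<in>UNIV. complex_of_real (v j) * iexp (l * a j)))\<^sup>2" for l
  define g where "g l = Re (\<Psi> l) / (1 + cmod (\<Psi> l))\<^sup>2" for l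
  have [measurable]: "F \<in> borel_measurable borel" "g \<in> borel_measurable borel"
    unfolding F_def g_def by measurable
  have Fint: "integrable lborel (\<lambda>l. F l * Re (1 / (complex_of_real q + \<Psi> l)))"
    and Feq: "energy q a v = 1 / (2 * pi) * (\<integral>l. F l * Re (1 / (complex_of_real q + \<Psi> l)) \<partial>lborel)" if "0 < q" for q
    using energy_eq_integral(1)[OF that, of v a] energy_eq_integral(2)[OF that, of a v] by (simp_all add: F_def)
  have nn: "0 \<le> F l" "0 \<le> g l" for l
    by (auto simp: F_def g_def Re_exponent_nonneg)
  have le: "F l * g l \<le> F l * Re (1 / (complex_of_real q + \<Psi> l))" if "0 < q" "q \<le> 1" for q l
    unfolding g_def using nn Re_inverse_exponent_ge[OF that] by (intro mult_left_mono) auto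
  have int: "integrable lborel (\<lambda>l. F l * g l)"
  proof (rule Bochner_Integration.integrable_bound[OF Fint[of 1]])
    show "AE l in lborel. norm (F l * g l) \<le> norm (F l * Re (1 / (complex_of_real 1 + \<Psi> l)))"
    proof (intro AE_I2)
      fix l
      have "0 \<le> F l * g l" using nn by (intro mult_nonneg_nonneg)
      then show "norm (F l * g l) \<le> norm (F l * Re (1 / (complex_of_real 1 + \<Psi> l)))"
        using le[of 1 l] by (simp only: real_norm_def) linarith
    qed
  qed (simp_all)
  define c where "c = 1 / (2 * pi) * (\<integral>l. F l * g l \<partial>lborel)"
  have "c \<le> energy q a v" if "0 < q" "q \<le> 1" for q
    unfolding c_def Feq[OF that(1)]
    using integral_mono[OF int Fint[OF that(1)] le[OF that]] by (intro mult_left_mono) auto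
  moreover have "0 < c"
  proof (rule ccontr)
    assume "\<not> 0 < c"
    moreover have "0 \<le> (\<integral>l. F l * g l \<partial>lborel)" using nn by (intro Bochner_Integration.integral_nonneg mult_nonneg_nonneg) auto
    ultimately have "(\<integral>l. F l * g l \<partial>lborel) = 0"
      unfolding c_def using pi_gt_zero by (auto simp: not_less mult_le_0_iff divide_le_0_iff)
    then have "AE l in lborel. F l * g l = 0"
      using int nn by (subst (asm) integral_nonneg_eq_0_iff_AE) auto
    then have "AE l in lborel. Re (\<Psi> l) = 0"
    proof -
      have "AE l in lborel. (\<Sum>j\<in>UNIV. complex_of_real (v j) * iexp (l * a j)) \<noteq> 0"
        by (rule trigonometric_sum_AE_nonzero[of a v k]) (use assms in auto)
      with \<open>AE l in lborel. F l * g l = 0\<close> show ?thesis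
      proof eventually_elim
        case (elim l)
        have "1 + cmod (\<Psi> l) \<noteq> 0" using norm_ge_zero[of "\<Psi> l"] by linarith
        then show ?case using elim by (auto simp: F_def g_def)
      qed
    qed
    then show False using not_AE_Re_exponent_zero by blast
  qed
  ultimately show ?thesis by blast
qed

text \<open>
  The energy of the charge \<open>\<delta>\<^sub>x - \<delta>\<^sub>0\<close> is nonnegative, which bounds \<open>r\<^sub>q(x) + r\<^sub>q(-x)\<close> by \<open>2 r\<^sub>q(0)\<close>.
  As \<open>r\<^sub>q\<close> is nonnegative, each summand obeys the same bound.
\<close>

lemma resolvent_kernel_le_twice_zero:
  assumes "0 < q" shows "resolvent_kernel q x \<le> 2 * resolvent_kernel q 0"
proof -
  have "0 \<le> energy q (\<lambda>b. if b then x else 0) (\<lambda>b. if b then 1 else - 1)"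
    by (rule energy_nonneg[OF assms])
  then have "resolvent_kernel q x + resolvent_kernel q (- x) \<le> 2 * resolvent_kernel q 0"
    by (simp add: energy_def UNIV_bool)
  then show ?thesis using resolvent_kernel_nonneg[OF assms, of "- x"] by linarith
qed

section \<open>Recurrence\<close>

lemma nn_integral_ball_indicator:
  "(\<integral>\<^sup>+\<omega>. indicator {-1<..<1} (X (max 0 t) \<omega>) \<partial>P 0) = emeasure (P 0) {\<omega> \<in> space (P 0). \<bar>X (max 0 t) \<omega>\<bar> < 1}"
proof -
  have "(\<integral>\<^sup>+\<omega>. indicator {-1<..<1} (X (max 0 t) \<omega>) \<partial>P 0) = (\<integral>\<^sup>+\<omega>. indicator {\<omega> \<in> space (P 0). \<bar>X (max 0 t) \<omega>\<bar> < 1} \<omega> \<partial>P 0)"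
    by (intro nn_integral_cong) (auto simp: indicator_def)
  also have "\<dots> = emeasure (P 0) {\<omega> \<in> space (P 0). \<bar>X (max 0 t) \<omega>\<bar> < 1}"
    by (rule nn_integral_indicator) measurable
  finally show ?thesis .
qed

lemma measurable_ball_probability [measurable]:
  "(\<lambda>t. emeasure (P 0) {\<omega> \<in> space (P 0). \<bar>X (max 0 t) \<omega>\<bar> < 1}) \<in> borel_measurable borel"
proof -
  interpret prob_space "P 0" by simp
  have "(\<lambda>(t, \<omega>). indicator {-1<..<1::real} (X (max 0 t) \<omega>) :: ennreal) \<in> borel_measurable (lborel \<Otimes>\<^sub>M P 0)"
    using measurable_compose[OF measurable_paths[of 0], of "indicator {-1<..<1} :: real \<Rightarrow> ennreal" borel]
    by (simp add: case_prod_beta')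
  from borel_measurable_nn_integral[OF this] show ?thesis
    by (simp add: nn_integral_ball_indicator)
qed

text \<open>
  The left-hand side is the \<open>q\<close>-resolvent measure of \<open>(-1, 1)\<close>: the integral of the
  density over an interval of length 2, on which the density is at most \<open>2 r\<^sub>q(0)\<close>.
\<close>

lemma resolvent_of_ball_le:
  assumes q: "0 < q"
  shows "(\<integral>\<^sup>+t. ennreal (indicator {0..} t * exp (- q * t)) * emeasure (P 0) {\<omega> \<in> space (P 0). \<bar>X (max 0 t) \<omega>\<bar> < 1} \<partial>lborel)
    \<le> ennreal (4 * resolvent_kernel q 0)"
proof -
  interpret pair_prob_space "exponential_time q" "P 0" by (rule pair_prob_space_time[OF q])
  have [measurable]: "resolvent_kernel q \<in> borel_measurable borel" by (rule measurable_resolvent_kernel[OF q])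
  define A :: "real set" where "A = {-1<..<1}"
  have [measurable]: "A \<in> sets borel" by (simp add: A_def)
  have m: "(\<lambda>p. indicator A (case p of (t, \<omega>) \<Rightarrow> X (max 0 t) \<omega>) :: ennreal) \<in> borel_measurable (lborel \<Otimes>\<^sub>M P 0)"
    by measurable
  note inner = nn_integral_ball_indicator[folded A_def]
  have "emeasure (killed_law q) A = (\<integral>\<^sup>+y. indicator A y \<partial>killed_law q)"
    by (rule nn_integral_indicator[symmetric]) (simp add: killed_law_def)
  also have "\<dots> = (\<integral>\<^sup>+p. indicator A (case p of (t, \<omega>) \<Rightarrow> X (max 0 t) \<omega>) \<partial>(exponential_time q \<Otimes>\<^sub>M P 0))"
    unfolding killed_law_def by (rule nn_integral_distr) measurable
  also have "\<dots> = (\<integral>\<^sup>+t. (\<integral>\<^sup>+\<omega>. indicator A (X (max 0 t) \<omega>) \<partial>P 0) \<partial>exponential_time q)"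
    using M2.nn_integral_fst[of "\<lambda>p. indicator A (case p of (t, \<omega>) \<Rightarrow> X (max 0 t) \<omega>)" "exponential_time q"] m
    by (simp cong: measurable_cong_sets)
  also have "\<dots> = (\<integral>\<^sup>+t. ennreal (exponential_density q t) * emeasure (P 0) {\<omega> \<in> space (P 0). \<bar>X (max 0 t) \<omega>\<bar> < 1} \<partial>lborel)"
    unfolding exponential_time_def inner by (rule nn_integral_density) measurable
  also have "\<dots> = (\<integral>\<^sup>+t. ennreal q * (ennreal (indicator {0..} t * exp (- q * t)) * emeasure (P 0) {\<omega> \<in> space (P 0). \<bar>X (max 0 t) \<omega>\<bar> < 1}) \<partial>lborel)"
  proof (intro nn_integral_cong)
    fix t :: real
    have "exponential_density q t = q * (indicator {0..} t * exp (- q * t))"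
      by (simp add: exponential_density_def indicator_def mult.commute)
    then show "ennreal (exponential_density q t) * emeasure (P 0) {\<omega> \<in> space (P 0). \<bar>X (max 0 t) \<omega>\<bar> < 1}
        = ennreal q * (ennreal (indicator {0..} t * exp (- q * t)) * emeasure (P 0) {\<omega> \<in> space (P 0). \<bar>X (max 0 t) \<omega>\<bar> < 1})"
      using q by (simp only: ennreal_mult' less_imp_le mult.assoc)
  qed
  also have "\<dots> = ennreal q * (\<integral>\<^sup>+t. ennreal (indicator {0..} t * exp (- q * t)) * emeasure (P 0) {\<omega> \<in> space (P 0). \<bar>X (max 0 t) \<omega>\<bar> < 1} \<partial>lborel)"
    by (rule nn_integral_cmult) measurable
  finally have 1: "emeasure (killed_law q) A = \<dots>" .
  have "emeasure (killed_law q) A = (\<integral>\<^sup>+x. ennreal (q * resolvent_kernel q x) * indicator A x \<partial>lborel)"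
    unfolding killed_law_density[OF q] by (rule emeasure_density) measurable
  also have "\<dots> \<le> (\<integral>\<^sup>+x. ennreal (q * (2 * resolvent_kernel q 0)) * indicator A x \<partial>lborel)"
    using resolvent_kernel_le_twice_zero[OF q] q
    by (intro nn_integral_mono mult_right_mono ennreal_leI mult_left_mono) auto
  also have "\<dots> = ennreal (q * (2 * resolvent_kernel q 0)) * ennreal 2"
    by (subst nn_integral_cmult_indicator) (simp_all add: A_def)
  also have "\<dots> = ennreal q * ennreal (4 * resolvent_kernel q 0)"
    using q resolvent_kernel_nonneg[OF q, of 0] by (simp add: ennreal_mult[symmetric] del: ennreal_numeral)
  finally have "ennreal q * (\<integral>\<^sup>+t. ennreal (indicator {0..} t * exp (- q * t)) * emeasure (P 0) {\<omega> \<in> space (P 0). \<bar>X (max 0 t) \<omega>\<bar> < 1} \<partial>lborel)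
      \<le> ennreal q * ennreal (4 * resolvent_kernel q 0)"
    unfolding 1 .
  then show ?thesis
    using q by (simp add: ennreal_mult_le_mult_iff)
qed

text \<open>
  By monotone convergence the \<open>q\<close>-resolvent measure of \<open>(-1, 1)\<close> increases to the expected time
  spent there, which is infinite.
\<close>

lemma resolvent_kernel_zero_at_top:
  assumes "recurrent_process P X"
  shows "filterlim (\<lambda>q. resolvent_kernel q 0) at_top (at_right 0)"
proof -
  define p where "p t = emeasure (P 0) {\<omega> \<in> space (P 0). \<bar>X (max 0 t) \<omega>\<bar> < 1}" for t
  define G where "G q = (\<integral>\<^sup>+t. ennreal (indicator {0..} t * exp (- q * t)) * p t \<partial>lborel)" for q :: real
  have [measurable]: "p \<in> borel_measurable borel"
    unfolding p_def by (rule measurable_ball_probability)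
  have "(\<lambda>n::nat. G (1 / (real n + 1))) \<longlonglongrightarrow> (\<integral>\<^sup>+t. indicator {0..} t * p t \<partial>lborel)"
    unfolding G_def
  proof (rule nn_integral_LIMSEQ)
    show "incseq (\<lambda>n t. ennreal (indicator {0..} t * exp (- (1 / (real n + 1)) * t)) * p t)"
    proof (rule incseq_SucI, rule le_funI)
      fix n :: nat and t :: real
      have "t / (real (Suc n) + 1) \<le> t / (real n + 1)" if "0 \<le> t"
        using that by (intro divide_left_mono) auto
      then have "indicator {0..} t * exp (- (1 / (real n + 1)) * t) \<le> indicator {0..} t * exp (- (1 / (real (Suc n) + 1)) * t)"
        by (simp add: indicator_def)
      then show "ennreal (indicator {0..} t * exp (- (1 / (real n + 1)) * t)) * p t
          \<le> ennreal (indicator {0..} t * exp (- (1 / (real (Suc n) + 1)) * t)) * p t"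
        by (intro mult_right_mono ennreal_leI) auto
    qed
    fix t :: real
    have "(\<lambda>n. indicator {0..} t * exp (- (1 / (real n + 1)) * t)) \<longlonglongrightarrow> indicator {0..} t"
      by real_asymp
    then have "(\<lambda>n. ennreal (indicator {0..} t * exp (- (1 / (real n + 1)) * t))) \<longlonglongrightarrow> ennreal (indicator {0..} t)"
      by (rule tendsto_ennrealI)
    moreover have "p t \<noteq> \<top>" unfolding p_def
      using prob_space.finite_measure[OF prob_space_P] by (simp add: finite_measure.emeasure_finite)
    ultimately have "(\<lambda>n. p t * ennreal (indicator {0..} t * exp (- (1 / (real n + 1)) * t))) \<longlonglongrightarrow> p t * ennreal (indicator {0..} t)"
      by (intro tendsto_mult_ennreal tendsto_const) auto
    then show "(\<lambda>n. ennreal (indicator {0..} t * exp (- (1 / (real n + 1)) * t)) * p t) \<longlonglongrightarrow> indicator {0..} t * p t"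
      by (simp add: mult.commute ennreal_indicator)
  qed measurable
  also have "(\<integral>\<^sup>+t. indicator {0..} t * p t \<partial>lborel) = (\<integral>\<^sup>+t\<in>{0..}. emeasure (P 0) {\<omega> \<in> space (P 0). \<bar>X t \<omega>\<bar> < 1} \<partial>lborel)"
    by (intro nn_integral_cong) (auto simp: indicator_def p_def)
  also have "\<dots> = \<infinity>"
    using assms unfolding recurrent_process_def by simp
  finally have lim: "(\<lambda>n::nat. G (1 / (real n + 1))) \<longlonglongrightarrow> \<infinity>" .
  have mono: "G q \<le> G q'" if "q' \<le> q" for q q'
    unfolding G_def using that
    by (intro nn_integral_mono mult_right_mono ennreal_leI) (auto simp: indicator_def mult_right_mono)
  show ?thesis
    unfolding filterlim_at_top
  proof
    fix Z :: real
    have "\<forall>\<^sub>F n in sequentially. ennreal (4 * Z) < G (1 / (real n + 1))"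
      using lim by (rule order_tendstoD) simp
    then obtain n :: nat where n: "ennreal (4 * Z) < G (1 / (real n + 1))"
      using eventually_happens'[OF sequentially_bot] by blast
    have "\<forall>\<^sub>F q in at_right 0. 0 < q \<and> q < 1 / (real n + 1)"
      by (auto simp: eventually_at_right_field intro!: exI[of _ "1 / (real n + 1)"])
    then show "\<forall>\<^sub>F q in at_right 0. Z \<le> resolvent_kernel q 0"
    proof eventually_elim
      case (elim q)
      have "ennreal (4 * Z) < G q" using n mono[of q "1 / (real n + 1)"] elim by (meson less_imp_le less_le_trans)
      also have "G q \<le> ennreal (4 * resolvent_kernel q 0)"
        unfolding G_def p_def using elim by (intro resolvent_of_ball_le) auto
      finally have less: "ennreal (4 * Z) < ennreal (4 * resolvent_kernel q 0)" .
      show ?case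
      proof (rule ccontr)
        assume "\<not> Z \<le> resolvent_kernel q 0"
        then have "ennreal (4 * resolvent_kernel q 0) \<le> ennreal (4 * Z)" by (intro ennreal_leI) simp
        with less show False by (simp add: not_less[symmetric])
      qed
    qed
  qed
qed

end

section \<open>Capacity measures of a finite set\<close>

locale levy_finite_set = levy_resolvent P X \<Psi>
  for P :: "real \<Rightarrow> 'w measure" and X :: "real \<Rightarrow> 'w \<Rightarrow> real" and \<Psi> :: "real \<Rightarrow> complex" +
  fixes a :: "'n::finite \<Rightarrow> real"
  assumes recurrent: "recurrent_process P X"
    and h_exists: "\<And>x::real. \<exists>l. ((\<lambda>q. h_resolvent P X q x) \<longlongrightarrow> l) (at_right 0)"
    and capacity_exists: "\<And>q::real. q > 0 \<Longrightarrow> \<exists>m. is_capacity_measure P X q (range a) m"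
    and inj_a: "inj a"
begin

abbreviation h :: "real \<Rightarrow> real" where
  "h \<equiv> renormalized_zero_resolvent P X"

lemma h_tendsto: "((\<lambda>q. h_resolvent P X q x) \<longlongrightarrow> h x) (at_right 0)"
  using h_exists[of x] unfolding renormalized_zero_resolvent_def
  by (metis tendsto_Lim trivial_limit_at_right_real)

lemma h_resolvent_eq: "0 < q \<Longrightarrow> h_resolvent P X q x = resolvent_kernel q 0 - resolvent_kernel q (- x)"
  by (simp add: h_resolvent_def resolvent_density_eq_resolvent_kernel)

lemma h_zero: "h 0 = 0"
  using h_tendsto[of 0] unfolding h_resolvent_def by (simp add: tendsto_const_iff)

lemma eventually_at_right_0_unit_interval: "\<forall>\<^sub>F q::real in at_right 0. 0 < q \<and> q \<le> 1"
  unfolding eventually_at_right_field by (intro exI[of _ 1]) auto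

text \<open>
  The integrand equals 1 almost surely. Its measurability comes from the completeness of
  the measure; without it the integral would be 0 by convention.
\<close>

lemma discount_at_start:
  "(\<integral>\<omega>. discount q (hitting_time X (range a) \<omega>) \<partial>completion (P (a j))) = 1"
proof -
  have "AE \<omega> in P (a j). discount q (hitting_time X (range a) \<omega>) = 1"
    using starts_at[of "a j"]
  proof eventually_elim
    case (elim \<omega>)
    have "hitting_time X (range a) \<omega> \<le> ereal 0"
      unfolding hitting_time_def by (rule INF_lower) (simp add: elim)
    moreover have "ereal 0 \<le> hitting_time X (range a) \<omega>"
      unfolding hitting_time_def by (rule INF_greatest) simp
    ultimately have "hitting_time X (range a) \<omega> = ereal 0" by (rule antisym)
    then show ?case by (simp add: discount_def)
  qed
  then have ae: "AE \<omega> in completion (P (a j)). discount q (hitting_time X (range a) \<omega>) = 1"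
    by (rule AE_completion)
  have "(\<lambda>\<omega>. discount q (hitting_time X (range a) \<omega>)) \<in> borel_measurable (completion (P (a j)))"
  proof (rule measurableI)
    fix A :: "real set" assume "A \<in> sets borel"
    let ?D = "(\<lambda>\<omega>. discount q (hitting_time X (range a) \<omega>)) -` A \<inter> space (completion (P (a j)))"
    let ?E = "if 1 \<in> A then space (completion (P (a j))) else {}"
    show "?D \<in> sets (completion (P (a j)))"
    proof (rule completion.in_sets_AE)
      show "AE \<omega> in completion (P (a j)). \<omega> \<in> ?E \<longleftrightarrow> \<omega> \<in> ?D"
        using ae AE_space by eventually_elim auto
    qed auto
  qed simp
  then have "(\<integral>\<omega>. discount q (hitting_time X (range a) \<omega>) \<partial>completion (P (a j))) = (\<integral>\<omega>. 1 \<partial>completion (P (a j)))"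
    using ae by (intro integral_cong_AE) auto
  then show ?thesis using prob_space.prob_space[OF prob_space_P[of "a j"]] by simp
qed

lemma capacity_linear_system:
  assumes "is_capacity_measure P X q (range a) m" "0 < q"
  shows "(\<Sum>i\<in>UNIV. resolvent_kernel q (a i - a j) * measure m {a i}) = 1"
proof -
  have [measurable]: "resolvent_kernel q \<in> borel_measurable borel" by (rule measurable_resolvent_kernel[OF assms(2)])
  have "(\<integral>y. resolvent_kernel q (y - a j) \<partial>m) = 1"
    using assms(1) discount_at_start[where q = q and j = j]
    unfolding is_capacity_measure_def resolvent_density_eq_resolvent_kernel[OF assms(2)] by metis
  moreover have "(\<integral>y. resolvent_kernel q (y - a j) \<partial>m) = (\<Sum>i\<in>UNIV. resolvent_kernel q (a i - a j) * measure m {a i})"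
    by (rule integral_finite_support[OF inj_a]) (use assms(1) in \<open>auto simp: is_capacity_measure_def\<close>)
  ultimately show ?thesis by simp
qed

text \<open>
  The linear system of the masses has only one solution, as its quadratic form, the energy, is
  positive definite. The
  bound \<open>q \<le> 1\<close> comes from \<open>energy_uniformly_positive\<close>.
\<close>

lemma is_capacity_measure_capacity_measure:
  assumes "0 < q" "q \<le> 1"
  shows "is_capacity_measure P X q (range a) (capacity_measure P X q (range a))"
proof -
  obtain m where m: "is_capacity_measure P X q (range a) m"
    using capacity_exists[OF assms(1)] by blast
  show ?thesis
    unfolding capacity_measure_def
  proof (rule theI)
    show "is_capacity_measure P X q (range a) m" by fact
    fix m' assume m': "is_capacity_measure P X q (range a) m'"
    define v where "v i = measure m' {a i} - measure m {a i}" for i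
    have sys: "(\<Sum>i\<in>UNIV. resolvent_kernel q (a i - a j) * v i) = 0" for j
      using capacity_linear_system[OF m assms(1), of j] capacity_linear_system[OF m' assms(1), of j]
      by (simp add: v_def right_diff_distrib sum_subtractf)
    have "energy q a v = (\<Sum>i\<in>UNIV. v i * (\<Sum>j\<in>UNIV. resolvent_kernel q (a j - a i) * v j))"
      by (simp add: energy_def sum_distrib_left mult_ac)
    also have "\<dots> = 0" by (simp add: sys)
    finally have "energy q a v = 0" .
    then have "v i = 0" for i
      using energy_uniformly_positive[of a v i] inj_a assms by fastforce
    then have "measure m' {a i} = measure m {a i}" for i
      by (simp add: v_def)
    then show "m' = m"
      using m m' by (intro finite_support_eqI[OF inj_a]) (auto simp: is_capacity_measure_def)
  qed
qed

text \<open>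
  The masses of the measures whose weak limit is the equilibrium measure.
\<close>

definition scaled_mass :: "real \<Rightarrow> 'n \<Rightarrow> real" where
  "scaled_mass q i = resolvent_kernel q 0 * measure (capacity_measure P X q (range a)) {a i}"

text \<open>
  The quantity whose limit is the Robin constant.
\<close>

definition robin_ratio :: "real \<Rightarrow> real" where
  "robin_ratio q = resolvent_kernel q 0 * ((\<Sum>i\<in>UNIV. scaled_mass q i) - 1)"

text \<open>
  The upper bound keeps only the diagonal term of the linear system, whose terms are
  all nonnegative.
\<close>

lemma scaled_mass_bounds:
  assumes "0 < q" "q \<le> 1"
  shows "0 \<le> scaled_mass q i" "scaled_mass q i \<le> 1"
proof -
  let ?m = "capacity_measure P X q (range a)"
  show "0 \<le> scaled_mass q i"
    using resolvent_kernel_nonneg[OF assms(1), of 0] by (simp add: scaled_mass_def)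
  have "scaled_mass q i = resolvent_kernel q (a i - a i) * measure ?m {a i}"
    by (simp add: scaled_mass_def)
  also have "\<dots> \<le> (\<Sum>j\<in>UNIV. resolvent_kernel q (a j - a i) * measure ?m {a j})"
    using resolvent_kernel_nonneg[OF assms(1)] by (intro member_le_sum[of i UNIV "\<lambda>j. resolvent_kernel q (a j - a i) * measure ?m {a j}"]) auto
  also have "\<dots> = 1"
    by (rule capacity_linear_system[OF is_capacity_measure_capacity_measure[OF assms] assms(1)])
  finally show "scaled_mass q i \<le> 1" .
qed

lemma robin_ratio_eq:
  assumes "0 < q" "q \<le> 1"
  shows "robin_ratio q = (\<Sum>i\<in>UNIV. h_resolvent P X q (a j - a i) * scaled_mass q i)"
proof -
  let ?m = "\<lambda>i. measure (capacity_measure P X q (range a)) {a i}" and ?r = "resolvent_kernel q"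
  have sys: "(\<Sum>i\<in>UNIV. ?r (a i - a j) * ?m i) = 1"
    by (rule capacity_linear_system[OF is_capacity_measure_capacity_measure[OF assms] assms(1)])
  have "(\<Sum>i\<in>UNIV. h_resolvent P X q (a j - a i) * scaled_mass q i)
      = (\<Sum>i\<in>UNIV. ?r 0 * (scaled_mass q i - ?r (a i - a j) * ?m i))"
    by (intro sum.cong refl) (simp add: h_resolvent_eq[OF assms(1)] scaled_mass_def algebra_simps)
  also have "\<dots> = ?r 0 * ((\<Sum>i\<in>UNIV. scaled_mass q i) - (\<Sum>i\<in>UNIV. ?r (a i - a j) * ?m i))"
    by (simp add: sum_distrib_left sum_subtractf right_diff_distrib)
  finally show ?thesis by (simp add: sys robin_ratio_def)
qed

text \<open>
  When the weights sum to zero, the constant part \<open>r\<^sub>q(0)\<close> of \<open>h\<^sub>q\<close> cancels and minus the energy remains.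
  Its lower bound survives the limit because it is uniform in \<open>q\<close>.
\<close>

lemma h_conditionally_negative_definite:
  assumes "(\<Sum>i\<in>UNIV. v i) = 0" "v k \<noteq> 0"
  shows "(\<Sum>i\<in>UNIV. \<Sum>j\<in>UNIV. v i * v j * h (a i - a j)) < 0"
proof -
  obtain c where c: "c > 0" "\<And>q. 0 < q \<Longrightarrow> q \<le> 1 \<Longrightarrow> c \<le> energy q a v"
    using energy_uniformly_positive[OF inj_a, of v k] assms(2) by blast
  have eq: "(\<Sum>i\<in>UNIV. \<Sum>j\<in>UNIV. v i * v j * h_resolvent P X q (a i - a j)) = - energy q a v" if "0 < q" for q
  proof -
    have "(\<Sum>i\<in>UNIV. \<Sum>j\<in>UNIV. v i * v j * h_resolvent P X q (a i - a j))
        = (\<Sum>i\<in>UNIV. \<Sum>j\<in>UNIV. resolvent_kernel q 0 * v i * v j) - energy q a v"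
      unfolding energy_def sum_subtractf[symmetric] h_resolvent_eq[OF that]
      by (intro sum.cong refl) (simp add: algebra_simps)
    also have "(\<Sum>i\<in>UNIV. \<Sum>j\<in>UNIV. resolvent_kernel q 0 * v i * v j) = 0"
      using assms(1) by (simp flip: sum_distrib_left)
    finally show ?thesis by simp
  qed
  have "(\<Sum>i\<in>UNIV. \<Sum>j\<in>UNIV. v i * v j * h (a i - a j)) \<le> - c"
  proof (rule tendsto_upperbound)
    show "((\<lambda>q. \<Sum>i\<in>UNIV. \<Sum>j\<in>UNIV. v i * v j * h_resolvent P X q (a i - a j))
        \<longlongrightarrow> (\<Sum>i\<in>UNIV. \<Sum>j\<in>UNIV. v i * v j * h (a i - a j))) (at_right 0)"
      by (intro tendsto_intros h_tendsto)
    show "\<forall>\<^sub>F q in at_right 0. (\<Sum>i\<in>UNIV. \<Sum>j\<in>UNIV. v i * v j * h_resolvent P X q (a i - a j)) \<le> - c"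
      using eventually_at_right_0_unit_interval by eventually_elim (use c eq in auto)
  qed simp
  with c(1) show ?thesis by simp
qed

section \<open>The equilibrium system\<close>

definition equilibrium_solution :: "('n \<Rightarrow> real) \<Rightarrow> real \<Rightarrow> bool" where
  "equilibrium_solution z k \<longleftrightarrow>
     (\<Sum>i\<in>UNIV. z i) = 1 \<and> (\<forall>j. (\<Sum>i\<in>UNIV. h (a j - a i) * z i) = k)"

text \<open>
  If \<open>v\<close> is the difference of two solutions, then \<open>H v\<close> is constant and \<open>1 \<bullet> v = 0\<close>, so the quadratic
  form of \<open>H\<close> vanishes at \<open>v\<close>.
\<close>

lemma equilibrium_solution_unique:
  assumes "equilibrium_solution z k" "equilibrium_solution z' k'"
  shows "z = z'" "k = k'"
proof -
  define v where "v i = z i - z' i" for i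
  have s: "(\<Sum>i\<in>UNIV. v i) = 0"
    using assms by (simp add: v_def sum_subtractf equilibrium_solution_def)
  have H: "(\<Sum>i\<in>UNIV. h (a j - a i) * v i) = k - k'" for j
    using assms by (simp add: v_def sum_subtractf right_diff_distrib equilibrium_solution_def)
  have "(\<Sum>j\<in>UNIV. \<Sum>i\<in>UNIV. v j * v i * h (a j - a i)) = (\<Sum>j\<in>UNIV. v j * (\<Sum>i\<in>UNIV. h (a j - a i) * v i))"
    by (simp add: sum_distrib_left mult_ac)
  also have "\<dots> = 0" unfolding H using s by (simp flip: sum_distrib_right)
  finally have "v i = 0" for i
    using h_conditionally_negative_definite[OF s, of i] by auto
  then show "z = z'" by (auto simp: v_def)
  with assms show "k = k'" by (auto simp: equilibrium_solution_def)
qed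

text \<open>
  The total mass exceeds 1 by \<open>robin_ratio q / r\<^sub>q(0)\<close>, a convergent quantity over a divergent one.
\<close>

lemma limit_point_is_solution:
  fixes z :: "'n \<Rightarrow> real"
  assumes u: "\<And>n::nat. 0 < u n" "u \<longlonglongrightarrow> 0" and z: "\<And>i. (\<lambda>n. scaled_mass (u n) i) \<longlonglongrightarrow> z i"
  shows "(\<forall>i. 0 \<le> z i) \<and> (\<exists>k. equilibrium_solution z k)"
proof -
  have filt: "filterlim u (at_right 0) sequentially"
    using u by (simp add: filterlim_at less_imp_neq[THEN not_sym])
  have ev: "\<forall>\<^sub>F n in sequentially. 0 < u n \<and> u n \<le> 1"
    using filterlim_iff[THEN iffD1, OF filt, rule_format, OF eventually_at_right_0_unit_interval] .
  have nn: "0 \<le> z i" for i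
    by (rule tendsto_lowerbound[OF z[of i]]) (use ev scaled_mass_bounds in \<open>auto elim!: eventually_mono\<close>)
  have rr: "(\<lambda>n. robin_ratio (u n)) \<longlonglongrightarrow> (\<Sum>i\<in>UNIV. h (a j - a i) * z i)" for j
  proof (rule Lim_transform_eventually)
    show "(\<lambda>n. \<Sum>i\<in>UNIV. h_resolvent P X (u n) (a j - a i) * scaled_mass (u n) i) \<longlonglongrightarrow> (\<Sum>i\<in>UNIV. h (a j - a i) * z i)"
      by (intro tendsto_intros z filterlim_compose[OF h_tendsto filt])
    show "\<forall>\<^sub>F n in sequentially. (\<Sum>i\<in>UNIV. h_resolvent P X (u n) (a j - a i) * scaled_mass (u n) i) = robin_ratio (u n)"
      using ev by eventually_elim (rule robin_ratio_eq[symmetric], auto)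
  qed
  have top: "filterlim (\<lambda>n. resolvent_kernel (u n) 0) at_top sequentially"
    by (rule filterlim_compose[OF resolvent_kernel_zero_at_top[OF recurrent] filt])
  have "(\<lambda>n. robin_ratio (u n) / resolvent_kernel (u n) 0) \<longlonglongrightarrow> 0"
    by (rule tendsto_divide_0[OF rr filterlim_at_top_imp_at_infinity[OF top]])
  moreover have "\<forall>\<^sub>F n in sequentially. robin_ratio (u n) / resolvent_kernel (u n) 0 = (\<Sum>i\<in>UNIV. scaled_mass (u n) i) - 1"
  proof -
    have "\<forall>\<^sub>F n in sequentially. 0 < resolvent_kernel (u n) 0"
      using top by (simp add: filterlim_at_top_dense)
    then show ?thesis by eventually_elim (simp add: robin_ratio_def)
  qed
  ultimately have "(\<lambda>n. (\<Sum>i\<in>UNIV. scaled_mass (u n) i) - 1) \<longlonglongrightarrow> 0"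
    by (rule Lim_transform_eventually)
  moreover have "(\<lambda>n. (\<Sum>i\<in>UNIV. scaled_mass (u n) i) - 1) \<longlonglongrightarrow> (\<Sum>i\<in>UNIV. z i) - 1"
    by (intro tendsto_intros z)
  ultimately have "(\<Sum>i\<in>UNIV. z i) = 1" using LIMSEQ_unique by fastforce
  \<comment> \<open>\<open>robin_ratio\<close> is the same for every row, hence so is its limit; \<open>undefined\<close> is just some index.\<close>
  moreover have "(\<Sum>i\<in>UNIV. h (a j - a i) * z i) = (\<Sum>i\<in>UNIV. h (a undefined - a i) * z i)" for j
    by (rule LIMSEQ_unique[OF rr rr])
  ultimately show ?thesis using nn by (auto simp: equilibrium_solution_def)
qed

lemma scaled_mass_converges:
  "\<exists>z k. equilibrium_solution z k \<and> (\<forall>i. 0 \<le> z i) \<and> (\<forall>i. ((\<lambda>q. scaled_mass q i) \<longlongrightarrow> z i) (at_right 0))"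
proof -
  define f :: "real \<Rightarrow> real ^ 'n" where "f q = (\<chi> i. scaled_mass q i)" for q
  define S where "S z \<longleftrightarrow> (\<forall>i. 0 \<le> z $ i) \<and> (\<exists>k. equilibrium_solution (\<lambda>i. z $ i) k)" for z :: "real ^ 'n"
  have "\<exists>z. S z \<and> (f \<longlongrightarrow> z) (at_right 0)"
  proof (rule tendsto_at_right_0_of_unique_limit_point)
    show "compact (cbox 0 1 :: (real ^ 'n) set)" by (rule compact_cbox)
    show "\<forall>\<^sub>F q in at_right 0. f q \<in> cbox 0 1"
      using eventually_at_right_0_unit_interval by eventually_elim (auto simp: mem_box_cart f_def scaled_mass_bounds)
    show "S z" if "\<And>n. 0 < u n" "u \<longlonglongrightarrow> 0" "(\<lambda>n. f (u n)) \<longlonglongrightarrow> z" for u z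
    proof -
      have "(\<lambda>n. scaled_mass (u n) i) \<longlonglongrightarrow> z $ i" for i
        using tendsto_vec_nth[OF that(3), of i] by (simp add: f_def)
      then show ?thesis using limit_point_is_solution[OF that(1,2), of "\<lambda>i. z $ i"] by (simp add: S_def)
    qed
    show "z = z'" if "S z" "S z'" for z z'
      using that equilibrium_solution_unique(1)[of "\<lambda>i. z $ i" _ "\<lambda>i. z' $ i"]
      unfolding S_def vec_eq_iff by metis
  qed
  then obtain z where z: "S z" "(f \<longlongrightarrow> z) (at_right 0)" by blast
  have "((\<lambda>q. scaled_mass q i) \<longlongrightarrow> z $ i) (at_right 0)" for i
    using tendsto_vec_nth[OF z(2), of i] by (simp add: f_def)
  with z(1) show ?thesis unfolding S_def by blast
qed

lemma scaled_mass_tendsto: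
  assumes "equilibrium_solution z k"
  shows "((\<lambda>q. scaled_mass q i) \<longlongrightarrow> z i) (at_right 0)" "0 \<le> z i"
proof -
  obtain z' k' where z': "equilibrium_solution z' k'" "\<And>i. 0 \<le> z' i" "\<And>i. ((\<lambda>q. scaled_mass q i) \<longlongrightarrow> z' i) (at_right 0)"
    using scaled_mass_converges by blast
  with equilibrium_solution_unique(1)[OF assms z'(1)]
  show "((\<lambda>q. scaled_mass q i) \<longlongrightarrow> z i) (at_right 0)" "0 \<le> z i" by auto
qed

lemma robin_constant_eq:
  assumes "equilibrium_solution z k"
  shows "robin_constant P X (range a) = k"
proof -
  have "((\<lambda>q. \<Sum>i\<in>UNIV. h_resolvent P X q (a undefined - a i) * scaled_mass q i) \<longlongrightarrow> (\<Sum>i\<in>UNIV. h (a undefined - a i) * z i)) (at_right 0)"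
    by (intro tendsto_intros h_tendsto scaled_mass_tendsto[OF assms])
  also have "(\<Sum>i\<in>UNIV. h (a undefined - a i) * z i) = k"
    using assms by (simp add: equilibrium_solution_def)
  finally have "((\<lambda>q. resolvent_density P X q 0 * (resolvent_density P X q 0 * measure (capacity_measure P X q (range a)) (range a) - 1)) \<longlongrightarrow> k) (at_right 0)"
  proof (rule Lim_transform_eventually)
    show "\<forall>\<^sub>F q in at_right 0. (\<Sum>i\<in>UNIV. h_resolvent P X q (a undefined - a i) * scaled_mass q i)
      = resolvent_density P X q 0 * (resolvent_density P X q 0 * measure (capacity_measure P X q (range a)) (range a) - 1)"
      using eventually_at_right_0_unit_interval
    proof eventually_elim
      case (elim q)
      let ?m = "capacity_measure P X q (range a)"
      have m: "is_capacity_measure P X q (range a) ?m"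
        using elim by (intro is_capacity_measure_capacity_measure) auto
      have "closed (range a)" by (simp add: finite_imp_closed)
      then have "measure ?m (range a) = (\<Sum>i\<in>UNIV. indicator (range a) (a i) * measure ?m {a i})"
        using m by (intro measure_finite_support[OF inj_a]) (auto simp: is_capacity_measure_def)
      then have "resolvent_kernel q 0 * measure ?m (range a) = (\<Sum>i\<in>UNIV. scaled_mass q i)"
        by (simp add: scaled_mass_def sum_distrib_left)
      then show ?case
        using robin_ratio_eq[of q undefined] elim
        by (simp add: robin_ratio_def resolvent_density_eq_resolvent_kernel)
    qed
  qed
  then show ?thesis
    unfolding robin_constant_def by (intro tendsto_Lim) auto
qed

lemma equilibrium_measure_eq:
  assumes "equilibrium_solution z k"
  shows "equilibrium_measure P X (range a) = weighted_points a z"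
proof -
  note z = scaled_mass_tendsto[OF assms]
  note wp = weighted_points[where w = z and a = a, OF z(2)]
  let ?m = "\<lambda>q. scale_measure (ennreal (resolvent_density P X q 0)) (capacity_measure P X q (range a))"
  have lim: "((\<lambda>q. \<integral>y. f y \<partial>?m q) \<longlongrightarrow> (\<Sum>i\<in>UNIV. f (a i) * z i)) (at_right 0)"
    if f: "continuous_on UNIV f" for f :: "real \<Rightarrow> real"
  proof (rule Lim_transform_eventually)
    show "((\<lambda>q. \<Sum>i\<in>UNIV. f (a i) * scaled_mass q i) \<longlongrightarrow> (\<Sum>i\<in>UNIV. f (a i) * z i)) (at_right 0)"
      by (intro tendsto_intros z(1))
    show "\<forall>\<^sub>F q in at_right 0. (\<Sum>i\<in>UNIV. f (a i) * scaled_mass q i) = (\<integral>y. f y \<partial>?m q)"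
      using eventually_at_right_0_unit_interval
    proof eventually_elim
      case (elim q)
      have m: "is_capacity_measure P X q (range a) (capacity_measure P X q (range a))"
        using elim by (intro is_capacity_measure_capacity_measure) auto
      have r: "resolvent_density P X q 0 = resolvent_kernel q 0" "0 \<le> resolvent_kernel q 0"
        using elim resolvent_kernel_nonneg by (auto simp: resolvent_density_eq_resolvent_kernel)
      have fin: "emeasure (capacity_measure P X q (range a)) A \<noteq> \<top>" for A
        using m unfolding is_capacity_measure_def by (simp add: finite_measure.emeasure_finite)
      have "(\<integral>y. f y \<partial>?m q) = (\<Sum>i\<in>UNIV. f (a i) * measure (?m q) {a i})"
      proof (rule integral_finite_support[OF inj_a])
        show "finite_measure (?m q)"
          by (rule finite_measureI) (simp add: space_scale_measure ennreal_mult_eq_top_iff fin)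
      qed (use m borel_measurable_continuous_onI[OF f] in \<open>auto simp: is_capacity_measure_def\<close>)
      then show ?case by (simp add: scaled_mass_def r)
    qed
  qed
  have weak: "weakly_tendsto ?m (weighted_points a z) (at_right 0)"
    unfolding weakly_tendsto_def
  proof (intro allI impI)
    fix f :: "real \<Rightarrow> real" assume f: "continuous_on UNIV f"
    have "(\<integral>y. f y \<partial>weighted_points a z) = (\<Sum>i\<in>UNIV. f (a i) * measure (weighted_points a z) {a i})"
      by (rule integral_finite_support[OF inj_a wp(1-3) borel_measurable_continuous_onI[OF f]])
    then show "((\<lambda>q. \<integral>y. f y \<partial>?m q) \<longlongrightarrow> (\<integral>y. f y \<partial>weighted_points a z)) (at_right 0)"
      using lim[OF f] by (simp add: measure_weighted_points_singleton[OF inj_a z(2)])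
  qed
  have prob: "prob_space (weighted_points a z)"
  proof
    have "measure (weighted_points a z) UNIV = 1"
      using wp(4)[of UNIV] assms by (simp add: equilibrium_solution_def)
    then show "emeasure (weighted_points a z) (space (weighted_points a z)) = 1"
      using wp(1,2) sets_eq_imp_space_eq[OF wp(1)] by (simp add: finite_measure.emeasure_eq_measure)
  qed
  show ?thesis
    unfolding equilibrium_measure_def
  proof (rule the_equality)
    show "prob_space (weighted_points a z) \<and> sets (weighted_points a z) = sets borel \<and>
        emeasure (weighted_points a z) (- range a) = 0 \<and> weakly_tendsto ?m (weighted_points a z) (at_right 0)"
      using prob wp weak by simp
    fix \<mu> assume \<mu>: "prob_space \<mu> \<and> sets \<mu> = sets borel \<and> emeasure \<mu> (- range a) = 0 \<and> weakly_tendsto ?m \<mu> (at_right 0)"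
    then have fin: "finite_measure \<mu>" by (auto simp: prob_space_def)
    show "\<mu> = weighted_points a z"
    proof (rule finite_support_eqI[OF inj_a])
      fix k
      obtain f :: "real \<Rightarrow> real" where f: "continuous_on UNIV f" "bounded (range f)" "\<And>i. f (a i) = (if i = k then 1 else 0)"
        using continuous_separation[OF inj_a, of k] by blast
      have "((\<lambda>q. \<integral>y. f y \<partial>?m q) \<longlongrightarrow> (\<integral>y. f y \<partial>\<mu>)) (at_right 0)"
        using \<mu> f unfolding weakly_tendsto_def by blast
      from tendsto_unique[OF trivial_limit_at_right_real this lim[OF f(1)]]
      have "(\<integral>y. f y \<partial>\<mu>) = (\<Sum>i\<in>UNIV. f (a i) * z i)" .
      moreover have "(\<integral>y. f y \<partial>\<mu>) = (\<Sum>i\<in>UNIV. f (a i) * measure \<mu> {a i})"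
        using \<mu> fin borel_measurable_continuous_onI[OF f(1)] by (intro integral_finite_support[OF inj_a]) auto
      ultimately show "measure \<mu> {a k} = measure (weighted_points a z) {a k}"
        by (simp add: f(3) measure_weighted_points_singleton[OF inj_a z(2)] if_distrib[of "\<lambda>x. x * _"] cong: if_cong)
    qed (use \<mu> fin wp in auto)
  qed
qed

text \<open>
  The hypothesis says that the column of \<open>H\<close> belonging to \<open>a k\<close> vanishes, so the unit mass at \<open>a k\<close>
  solves the equilibrium system with constant \<open>0\<close>.
\<close>

lemma concentrated_solution:
  assumes "\<And>j. h (a j - a k) = 0"
  shows "equilibrium_measure P X (range a) = return borel (a k)" "robin_constant P X (range a) = 0"
proof -
  let ?z = "\<lambda>i. if i = k then 1 else 0 :: real"
  have sol: "equilibrium_solution ?z 0"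
    using assms by (simp add: equilibrium_solution_def if_distrib[of "\<lambda>x. _ * x"] cong: if_cong)
  show "robin_constant P X (range a) = 0" by (rule robin_constant_eq[OF sol])
  have "weighted_points a ?z = return borel (a k)"
  proof (rule finite_support_eqI[OF inj_a])
    show "finite_measure (return borel (a k))"
      using prob_space_return[of "a k" borel] by (simp add: prob_space_def)
    have "closed (range a)" by (simp add: finite_imp_closed)
    then show "emeasure (return borel (a k)) (- range a) = 0" by auto
    show "measure (weighted_points a ?z) {a i} = measure (return borel (a k)) {a i}" for i
      using inj_a by (subst measure_weighted_points_singleton[OF inj_a]) (auto simp: measure_return inj_eq indicator_def)
  qed (simp_all add: weighted_points)
  then show "equilibrium_measure P X (range a) = return borel (a k)"
    by (simp add: equilibrium_measure_eq[OF sol])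
qed

text \<open>
  The solution \<open>(z, k)\<close> that exists by compactness has \<open>k > 0\<close>: some \<open>z i\<close> is positive, and
  another row of the system, available as there are at least two points, bounds \<open>k\<close> from below by a
  positive multiple of it. Uniqueness then makes \<open>H\<close> injective, and \<open>w = z / k\<close>.
\<close>

lemma positive_h_solution:
  assumes "\<And>x. x \<noteq> 0 \<Longrightarrow> h x > 0" "CARD('n) \<ge> 2"
  defines "H \<equiv> difference_matrix h a"
  defines "w \<equiv> matrix_inv H *v 1"
  shows "equilibrium_solution (\<lambda>i. w $ i / (1 \<bullet> w)) (1 / (1 \<bullet> w))"
proof -
  obtain z k where z: "equilibrium_solution z k" "\<And>i. 0 \<le> z i"
    using scaled_mass_converges by blast
  have hnn: "0 \<le> h x" for x using assms(1)[of x] h_zero by (cases "x = 0") auto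
  have "\<exists>i. z i \<noteq> 0"
  proof (rule ccontr)
    assume "\<not> ?thesis"
    then show False using z(1) by (simp add: equilibrium_solution_def)
  qed
  then obtain i where i: "0 < z i" using z(2) by (metis less_eq_real_def)
  obtain j where j: "j \<noteq> i"
  proof -
    have "UNIV \<noteq> {i}" using assms(2) by (metis card.empty card_insert_disjoint empty_iff finite.emptyI not_less_eq_eq numeral_2_eq_2 One_nat_def le_refl)
    then show ?thesis using that by auto
  qed
  have "0 < h (a j - a i) * z i" using i j inj_a assms(1)[of "a j - a i"] by (simp add: inj_eq)
  also have "\<dots> \<le> (\<Sum>i\<in>UNIV. h (a j - a i) * z i)"
    using hnn z(2) by (intro member_le_sum[of i UNIV "\<lambda>i. h (a j - a i) * z i"]) auto
  also have "\<dots> = k" using z(1) by (simp add: equilibrium_solution_def)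
  finally have k: "0 < k" .
  have Hv: "(H *v x) $ j = (\<Sum>i\<in>UNIV. h (a j - a i) * x $ i)" for x j
    by (simp add: H_def difference_matrix_def matrix_vector_mult_def)
  have "x = 0" if x: "H *v x = 0" for x
  proof (rule ccontr)
    assume "x \<noteq> 0"
    have Hx: "(\<Sum>i\<in>UNIV. h (a j - a i) * x $ i) = 0" for j
      using Hv[of x j] x by simp
    define s where "s = (\<Sum>i\<in>UNIV. x $ i)"
    show False
    \<comment> \<open>With sum zero, adding \<open>x\<close> to \<open>z\<close> gives a second solution; otherwise \<open>x / s\<close> is a solution with
      constant 0.\<close>
    proof (cases "s = 0")
      case True
      have "equilibrium_solution (\<lambda>i. z i + x $ i) k"
        using z(1) True Hx by (simp add: equilibrium_solution_def sum.distrib distrib_left s_def)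
      from equilibrium_solution_unique(1)[OF this z(1)] have "x $ i = 0" for i
        by (simp add: fun_eq_iff)
      then show False using \<open>x \<noteq> 0\<close> by (simp add: vec_eq_iff)
    next
      case False
      have "equilibrium_solution (\<lambda>i. x $ i / s) 0"
        using False Hx by (simp add: equilibrium_solution_def s_def sum_divide_distrib[symmetric])
      from equilibrium_solution_unique(2)[OF this z(1)] k show False by simp
    qed
  qed
  then obtain B where "B ** H = mat 1"
    using matrix_left_invertible_ker[of H] by blast
  then have inv: "invertible H" by (simp add: invertible_left_inverse) blast
  have "H *v (\<chi> i. z i / k) = 1"
    using z(1) k by (simp add: vec_eq_iff Hv equilibrium_solution_def sum_divide_distrib[symmetric])
  then have "w = (matrix_inv H ** H) *v (\<chi> i. z i / k)"
    unfolding w_def by (simp add: matrix_vector_mul_assoc[symmetric])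
  also have "\<dots> = (\<chi> i. z i / k)"
  proof -
    have "matrix_inv H ** H = mat 1"
      using inv unfolding invertible_def matrix_inv_def by (rule someI2_ex) simp
    then show ?thesis by simp
  qed
  finally have w: "w $ i = z i / k" for i by simp
  have sw: "1 \<bullet> w = 1 / k"
    using z(1) by (simp add: inner_vec_def w equilibrium_solution_def sum_divide_distrib[symmetric])
  show "equilibrium_solution (\<lambda>i. w $ i / (1 \<bullet> w)) (1 / (1 \<bullet> w))"
    using z(1) k by (simp add: sw w)
qed

end

theorem proposition4p3:
  fixes P :: "real \<Rightarrow> 'w measure"
    and X :: "real \<Rightarrow> 'w \<Rightarrow> real"
    and \<Psi> :: "real \<Rightarrow> complex"
    and a :: "'n::{finite,linorder} \<Rightarrow> real"
  assumes levy: "levy_process P X"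
    and exponent: "characteristic_exponent P X \<Psi>"
    and recurrent: "recurrent_process P X"
    and integrable: "\<And>q::real. q > 0 \<Longrightarrow>
          set_integrable lborel {0..} (\<lambda>l. 1 / (complex_of_real q + \<Psi> l))"
    and h_exists: "\<And>x::real. \<exists>l. ((\<lambda>q. h_resolvent P X q x) \<longlongrightarrow> l) (at_right 0)"
    and capacity_exists: "\<And>q::real. q > 0 \<Longrightarrow> \<exists>m. is_capacity_measure P X q (range a) m"
    and n_ge_2: "CARD('n) \<ge> 2"
    and increasing: "strict_mono a"
  shows
    "((\<forall>x<0. renormalized_zero_resolvent P X x = 0) \<longrightarrow>
        equilibrium_measure P X (range a) = return borel (a (Max UNIV)) \<and>
        robin_constant P X (range a) = 0) \<and>
     ((\<forall>x>0. renormalized_zero_resolvent P X x = 0) \<longrightarrow>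
        equilibrium_measure P X (range a) = return borel (a (Min UNIV)) \<and>
        robin_constant P X (range a) = 0) \<and>
     ((\<forall>x. x \<noteq> 0 \<longrightarrow> renormalized_zero_resolvent P X x > 0) \<longrightarrow>
        (let H = difference_matrix (renormalized_zero_resolvent P X) a;
             w = matrix_inv H *v 1;
             \<mu> = equilibrium_measure P X (range a)
         in sets \<mu> = sets borel \<and>
            (\<forall>A\<in>sets borel. measure \<mu> A =
               1 / (1 \<bullet> w) * (\<Sum>i\<in>UNIV. w $ i * measure (return borel (a i)) A)) \<and>
            robin_constant P X (range a) = 1 / (1 \<bullet> w)))"
proof -
  interpret levy_finite_set P X \<Psi> a
  proof
    show "inj a" using increasing by (rule strict_mono_imp_inj_on)
  qed fact+
  have top: "a j - a (Max UNIV) < 0 \<or> a j - a (Max UNIV) = 0" for j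
    using Max_ge[of UNIV j] strict_mono_less_eq[OF increasing, of j "Max UNIV"] by auto
  have bot: "a j - a (Min UNIV) > 0 \<or> a j - a (Min UNIV) = 0" for j
    using Min_le[of UNIV j] strict_mono_less_eq[OF increasing, of "Min UNIV" j] by auto
  show ?thesis
  proof (intro conjI impI)
    assume "\<forall>x<0. h x = 0"
    then have "h (a j - a (Max UNIV)) = 0" for j using top[of j] h_zero by auto
    then show "equilibrium_measure P X (range a) = return borel (a (Max UNIV))"
      "robin_constant P X (range a) = 0"
      by (auto intro: concentrated_solution)
  next
    assume "\<forall>x>0. h x = 0"
    then have "h (a j - a (Min UNIV)) = 0" for j using bot[of j] h_zero by auto
    then show "equilibrium_measure P X (range a) = return borel (a (Min UNIV))"
      "robin_constant P X (range a) = 0"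
      by (auto intro: concentrated_solution)
  next
    assume pos: "\<forall>x. x \<noteq> 0 \<longrightarrow> h x > 0"
    define w where "w = matrix_inv (difference_matrix h a) *v 1"
    have sol: "equilibrium_solution (\<lambda>i. w $ i / (1 \<bullet> w)) (1 / (1 \<bullet> w))"
      unfolding w_def by (rule positive_h_solution) (use pos n_ge_2 in auto)
    have nn: "0 \<le> w $ i / (1 \<bullet> w)" for i by (rule scaled_mass_tendsto(2)[OF sol])
    have "measure (weighted_points a (\<lambda>i. w $ i / (1 \<bullet> w))) A
        = 1 / (1 \<bullet> w) * (\<Sum>i\<in>UNIV. w $ i * measure (return borel (a i)) A)" if "A \<in> sets borel" for A
      unfolding weighted_points(4)[where w = "\<lambda>i. w $ i / (1 \<bullet> w)", OF nn that] sum_distrib_left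
      using that by (intro sum.cong refl) (simp add: measure_return)
    then show "let H = difference_matrix h a; w = matrix_inv H *v 1; \<mu> = equilibrium_measure P X (range a)
       in sets \<mu> = sets borel \<and>
          (\<forall>A\<in>sets borel. measure \<mu> A = 1 / (1 \<bullet> w) * (\<Sum>i\<in>UNIV. w $ i * measure (return borel (a i)) A)) \<and>
          robin_constant P X (range a) = 1 / (1 \<bullet> w)"
      unfolding Let_def w_def[symmetric] equilibrium_measure_eq[OF sol] robin_constant_eq[OF sol]
      by (simp add: weighted_points(1)[OF nn])
  qed
qed

end
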